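(* Let $n,n'$ be positive integers, let $A=(A_{ij})$ be an $n\times n$ matrix, $B=(B_{i'j'})$ an $n'\times n'$ matrix, $U=(U_{i'j})$ an $n'\times n$ matrix and $V=(V_{ij'})$ an $n\times n'$ matrix. Let $\theta=(\theta_i)$, $\phi=(\phi_i)$ be row vectors of length $n$ and $\theta'=(\theta'_{i'})$, $\phi'=(\phi'_{i'})$ row vectors of length $n'$. Put $$\widetilde B=B+U(I-A)^{-1}V,\qquad \widetilde\theta=\theta'+\theta(I-A)^{-1}V,\qquad \widetilde\phi^{\,T}=\phi'^{\,T}+U(I-A)^{-1}\phi^{T}.$$ Then $$\sum_{\mathbf r\in\mathbb{Z}_{\ge0}^n}\frac{1}{\mathbf r!}\,\mathrm{pperm}_{\beta\theta\phi}\begin{bmatrix} B & U(n^{\mathbf r})\\ V(n^{\mathbf r}) & A(n^{\mathbf r},n^{\mathbf r})\end{bmatrix}=\frac{e^{\theta(I-A)^{-1}\phi^{T}}\cdot\mathrm{pperm}_{\beta\widetilde\theta\widetilde\phi}\,\widetilde B}{\det(I-A)^{\beta}},$$ where on the left the extended partial permanent is formed with the $(n'+N)$-vectors $(\theta'_{1'},\ldots,\theta'_{n'},\theta_{1_1},\ldots,\theta_{n_{r_n}})$ and $(\phi'_{1'},\ldots,\phi'_{n'},\phi_{1_1},\ldots,\phi_{n_{r_n}})$, with $N=r_1+\cdots+r_n$, $\theta_{i_a}=\theta_i$ and $\phi_{i_a}=\phi_i$.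
   Context: Partial permutations: a partial permutation $\psi$ of a finite set $X$ is an injective partial map from $X$ to itself, with domain $\mathrm{dom}\,\psi\subseteq X$ and image $\mathrm{im}\,\psi\subseteq X$ (the empty map is allowed). Let $C(\pi_\psi)$ denote the number of cycles of $\psi$, i.e. the number of cycles of the (possibly empty) permutation $\pi_\psi$ obtained by restricting $\psi$ to the largest subset of $X$ that $\psi$ maps bijectively onto itself (fixed points count as cycles of length 1). Extended partial permanent: for a square matrix $M=(M_{xy})$ indexed by a finite set $X$ and vectors $\theta=(\theta_x)_{x\in X}$, $\phi=(\phi_x)_{x\in X}$, $$\mathrm{pperm}_{\beta\theta\phi}M=\sum_{\psi}\beta^{C(\pi_\psi)}\prod_{x\in\mathrm{dom}\,\psi}M_{x\psi(x)}\prod_{y\notin\mathrm{im}\,\psi}\theta_y\prod_{z\notin\mathrm{dom}\,\psi}\phi_z,$$ the sum being over all partial permutations $\psi$ of $X$. Multisets: for $\mathbf r=(r_1,\ldots,r_n)\in\mathbb{Z}_{\ge0}^n$ put $\mathbf r!=r_1!\cdots r_n!$, $N=r_1+\cdots+r_n$, and let $n^{\mathbf r}=\{1_1,\ldots,1_{r_1},\ldots,n_1,\ldots,n_{r_n}\}$ be the multiset of size $N$ in which the index $i$ is repeated $r_i$ times; the labelled copies $i_a$ ($1\le a\le r_i$) are treated as $N$ distinct indices. $A(n^{\mathbf r},n^{\mathbf r})$ is the $N\times N$ matrix indexed by $n^{\mathbf r}$ with $(i_a,j_b)$ entry $A_{ij}$; $U(n^{\mathbf r})$ is the $n'\times N$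 matrix with $(i',j_b)$ entry $U_{i'j}$; $V(n^{\mathbf r})$ is the $N\times n'$ matrix with $(i_a,j')$ entry $V_{ij'}$. The block matrix is $(n'+N)\times(n'+N)$, indexed by $\{1',\ldots,n'\}\cup n^{\mathbf r}$; for $\mathbf r=(0,\ldots,0)$ it is just $B$. Interpretation: $\beta$, the entries of $A,B,U,V$, and the components of $\theta,\phi,\theta',\phi'$ are commuting indeterminates and the identity is one of formal power series with rational coefficients in them; $(I-A)^{-1}=\sum_{k\ge0}A^k$ and $\det(I-A)^{-\beta}$ means $\exp\left(\beta\sum_{t\ge1}\frac1t\mathrm{Tr}(A^t)\right)$. $I$ is the identity matrix and $T$ denotes transpose. *)

theory Defs
  imports
    "HOL-Analysis.Analysis"
    "HOL-Library.Poly_Mapping"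
    "HOL-Combinatorics.Orbits"
begin

section \<open>Formal power series in arbitrarily many commuting indeterminates\<close>

text \<open>Monomials in the indeterminates \<open>'v\<close> are finitely supported exponent functions
  \<open>'v \<Rightarrow>\<^sub>0 nat\<close>; a formal power series is an arbitrary family of coefficients.\<close>

typedef ('v, 'a) mfps = "UNIV :: (('v \<Rightarrow>\<^sub>0 nat) \<Rightarrow> 'a) set"
  morphisms mfps_coeff Abs_mfps
  by simp

setup_lifting type_definition_mfps

lemma mfps_eqI: "(\<And>m. mfps_coeff f m = mfps_coeff g m) \<Longrightarrow> f = g"
  by transfer auto

lemma finite_mfps_splittings: "finite {(a, b). a + b = (m :: 'v \<Rightarrow>\<^sub>0 nat)}"
proof -
  let ?lk = "Poly_Mapping.lookup"
  let ?K = "Poly_Mapping.keys m"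
  let ?B = "Max (insert 0 (?lk m ` ?K))"
  let ?F = "{f. \<forall>x. (x \<in> ?K \<longrightarrow> f x \<in> {0..?B}) \<and> (x \<notin> ?K \<longrightarrow> f x = (0::nat))}"
  let ?A = "{a. \<exists>b. a + b = m}"
  have le: "?lk a x \<le> ?lk m x" if "a \<in> ?A" for a x
    using that by (auto simp: lookup_add)
  have sub: "?lk ` ?A \<subseteq> ?F"
  proof clarify
    fix a b x
    assume "m = a + b"
    then have *: "?lk a x \<le> ?lk m x"
      using le[of a x] by auto
    have "?lk m x \<le> ?B" if "x \<in> ?K"
      using that by (intro Max_ge) auto
    with * have "x \<in> ?K \<Longrightarrow> ?lk a x \<in> {0..?B}"
      using order_trans atLeastAtMost_iff zero_le by metis
    moreover have "x \<notin> ?K \<Longrightarrow> ?lk a x = 0"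
      using * by (simp add: in_keys_iff)
    ultimately show "(x \<in> Poly_Mapping.keys (a + b) \<longrightarrow>
        ?lk a x \<in> {0..Max (insert 0 (?lk (a + b) ` Poly_Mapping.keys (a + b)))}) \<and>
        (x \<notin> Poly_Mapping.keys (a + b) \<longrightarrow> ?lk a x = 0)"
      unfolding \<open>m = a + b\<close> by blast
  qed
  have "finite ?F"
    by (rule finite_set_of_finite_funs) auto
  with sub have "finite (?lk ` ?A)"
    by (rule finite_subset)
  then have fin: "finite ?A"
    by (rule finite_imageD) (auto intro!: inj_onI poly_mapping_eqI)
  show ?thesis
    by (rule finite_subset[OF _ finite_cartesian_product[OF fin fin]])
      (auto intro: add.commute)
qed

instantiation mfps :: (type, comm_ring_1) comm_ring_1
begin

lift_definition zero_mfps :: "('a, 'b) mfps" is "\<lambda>_. 0" .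

lift_definition one_mfps :: "('a, 'b) mfps" is "\<lambda>m. if m = 0 then 1 else 0" .

lift_definition plus_mfps :: "('a, 'b) mfps \<Rightarrow> ('a, 'b) mfps \<Rightarrow> ('a, 'b) mfps"
  is "\<lambda>f g m. f m + g m" .

lift_definition minus_mfps :: "('a, 'b) mfps \<Rightarrow> ('a, 'b) mfps \<Rightarrow> ('a, 'b) mfps"
  is "\<lambda>f g m. f m - g m" .

lift_definition uminus_mfps :: "('a, 'b) mfps \<Rightarrow> ('a, 'b) mfps"
  is "\<lambda>f m. - f m" .

lift_definition times_mfps :: "('a, 'b) mfps \<Rightarrow> ('a, 'b) mfps \<Rightarrow> ('a, 'b) mfps"
  is "\<lambda>f g m. \<Sum>(a, b)\<in>{(a, b). a + b = m}. f a * g b" .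

instance
proof
  fix f g h :: "('a, 'b) mfps"
  show "f + g + h = f + (g + h)" by transfer (simp add: add.assoc)
  show "f + g = g + f" by transfer (simp add: add.commute)
  show "0 + f = f" by transfer simp
  show "- f + f = 0" by transfer simp
  show "f - g = f + - g" by transfer simp
  show "(0 :: ('a, 'b) mfps) \<noteq> 1" by transfer (metis zero_neq_one)
  show "(f + g) * h = f * h + g * h"
    by transfer (simp add: case_prod_unfold distrib_right sum.distrib)
  show "f * g = g * f"
  proof (transfer, rule ext)
    fix f g :: "('a \<Rightarrow>\<^sub>0 nat) \<Rightarrow> 'b" and m
    show "(\<Sum>(a, b)\<in>{(a, b). a + b = m}. f a * g b) = (\<Sum>(a, b)\<in>{(a, b). a + b = m}. g a * f b)"
      by (rule sum.reindex_bij_witness[of _ prod.swap prod.swap]) (auto simp: ac_simps)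
  qed
  show "1 * f = f"
  proof (transfer, rule ext)
    fix f :: "('a \<Rightarrow>\<^sub>0 nat) \<Rightarrow> 'b" and m
    have "(\<Sum>(a, b)\<in>{(a, b). a + b = m}. (if a = 0 then 1 else 0) * f b)
        = (\<Sum>(a, b)\<in>{(0 :: 'a \<Rightarrow>\<^sub>0 nat, m)}. (if a = 0 then 1 else 0) * f b)"
      by (rule sum.mono_neutral_right) (auto simp: finite_mfps_splittings split: if_splits)
    then show "(\<Sum>(a, b)\<in>{(a, b). a + b = m}. (if a = 0 then 1 else 0) * f b) = f m"
      by simp
  qed
  show "f * g * h = f * (g * h)"
  proof (transfer, rule ext)
    fix f g h :: "('a \<Rightarrow>\<^sub>0 nat) \<Rightarrow> 'b" and m
    let ?S = "\<lambda>m. {(a, b). a + b = (m :: 'a \<Rightarrow>\<^sub>0 nat)}"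
    have "(\<Sum>(a, b)\<in>?S m. (\<Sum>(c, d)\<in>?S a. f c * g d) * h b)
        = (\<Sum>p\<in>?S m. \<Sum>q\<in>?S (fst p). f (fst q) * g (snd q) * h (snd p))"
      by (simp add: case_prod_unfold sum_distrib_right)
    also have "\<dots> = (\<Sum>(p, q)\<in>(SIGMA p:?S m. ?S (fst p)). f (fst q) * g (snd q) * h (snd p))"
      by (rule sum.Sigma) (use finite_mfps_splittings in blast)+
    also have "\<dots> = (\<Sum>(p, q)\<in>(SIGMA p:?S m. ?S (snd p)). f (fst p) * (g (fst q) * h (snd q)))"
      by (rule sum.reindex_bij_witness[of _
            "\<lambda>((a, s), (c, b)). ((a + c, b), (a, c))" "\<lambda>((s, b), (a, c)). ((a, c + b), (c, b))"])
        (auto simp: ac_simps)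
    also have "\<dots> = (\<Sum>p\<in>?S m. \<Sum>q\<in>?S (snd p). f (fst p) * (g (fst q) * h (snd q)))"
      by (rule sum.Sigma[symmetric]) (use finite_mfps_splittings in blast)+
    also have "\<dots> = (\<Sum>(a, b)\<in>?S m. f a * (\<Sum>(c, d)\<in>?S b. g c * h d))"
      by (simp add: case_prod_unfold sum_distrib_left)
    finally show "(\<Sum>(a, b)\<in>?S m. (\<Sum>(c, d)\<in>?S a. f c * g d) * h b)
        = (\<Sum>(a, b)\<in>?S m. f a * (\<Sum>(c, d)\<in>?S b. g c * h d))" .
  qed
qed

end

lift_definition mfps_const :: "'a::zero \<Rightarrow> ('v, 'a) mfps"
  is "\<lambda>c m. if m = 0 then c else 0" .

lift_definition mfps_var :: "'v \<Rightarrow> ('v, 'a::zero_neq_one) mfps"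
  is "\<lambda>v m. if m = Poly_Mapping.single v 1 then 1 else 0" .

text \<open>Formal summation of a family of series: each monomial may occur in only finitely many
  members, and coefficients are added. (This is unconditional convergence in the product topology
  with discrete coefficients.) The operator \<open>mfps_sum\<close> returns the sum of such a family;
  \<open>Sum_any\<close> gives a meaningless coefficient 0 at monomials occurring infinitely often.\<close>

definition mfps_has_sum :: "('i \<Rightarrow> ('v, 'a::comm_ring_1) mfps) \<Rightarrow> ('v, 'a) mfps \<Rightarrow> bool" where
  "mfps_has_sum f s \<longleftrightarrow>
     (\<forall>m. finite {i. mfps_coeff (f i) m \<noteq> 0} \<and>
          mfps_coeff s m = (\<Sum>i | mfps_coeff (f i) m \<noteq> 0. mfps_coeff (f i) m))"

definition mfps_sum :: "('i \<Rightarrow> ('v, 'a::comm_ring_1) mfps) \<Rightarrow> ('v, 'a) mfps" where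
  "mfps_sum f = Abs_mfps (\<lambda>m. Sum_any (\<lambda>i. mfps_coeff (f i) m))"

lemma mfps_sum_eqI: "mfps_has_sum f s \<Longrightarrow> mfps_sum f = s"
  by (rule mfps_eqI)
    (simp add: mfps_has_sum_def mfps_sum_def Sum_any.expand_set Abs_mfps_inverse)

lemma mfps_has_sum_mfps_sum:
  "(\<And>m. finite {i. mfps_coeff (f i) m \<noteq> 0}) \<Longrightarrow> mfps_has_sum f (mfps_sum f)"
  by (simp add: mfps_has_sum_def mfps_sum_def Sum_any.expand_set Abs_mfps_inverse)

text \<open>Meaningful when the constant coefficient of \<open>f\<close> vanishes.\<close>

definition mfps_exp :: "('v, 'a::field_char_0) mfps \<Rightarrow> ('v, 'a) mfps" where
  "mfps_exp f = mfps_sum (\<lambda>k. mfps_const (1 / fact k) * f ^ k)"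


section \<open>Matrices of formal power series\<close>

text \<open>The power operator \<open>^\<close> on \<open>'a^'n^'n\<close> acts entrywise, so powers for \<open>**\<close> are
  defined separately.\<close>

primrec matrix_power :: "'a::semiring_1^'n^'n \<Rightarrow> nat \<Rightarrow> 'a^'n^'n" where
  "matrix_power A 0 = mat 1"
| "matrix_power A (Suc k) = A ** matrix_power A k"

text \<open>\<open>(I - A)\<^sup>-\<^sup>1 = (\<Sum>k\<ge>0. A\<^sup>k)\<close>, summed entrywise.\<close>

definition inv_one_minus :: "('v, 'a::comm_ring_1) mfps^'n^'n \<Rightarrow> ('v, 'a) mfps^'n^'n" where
  "inv_one_minus A = (\<chi> i j. mfps_sum (\<lambda>k. matrix_power A k $ i $ j))"

text \<open>\<open>det (I - A)\<close> to the power \<open>-b\<close>, i.e. \<open>exp (b * (\<Sum>t\<ge>1. trace (A\<^sup>t) / t))\<close>; below, \<open>t\<close> is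
  shifted by one.\<close>

definition det_one_minus_neg_power ::
    "('v, 'a::field_char_0) mfps^'n^'n \<Rightarrow> ('v, 'a) mfps \<Rightarrow> ('v, 'a) mfps" where
  "det_one_minus_neg_power A b =
     mfps_exp (b * mfps_sum (\<lambda>t. mfps_const (1 / of_nat (Suc t)) * trace (matrix_power A (Suc t))))"


section \<open>Partial permutations and the extended partial permanent\<close>

definition partial_perms :: "'x set \<Rightarrow> ('x \<rightharpoonup> 'x) set" where
  "partial_perms X = {\<psi>. dom \<psi> \<subseteq> X \<and> ran \<psi> \<subseteq> X \<and> inj_on \<psi> (dom \<psi>)}"

text \<open>The largest set that \<open>\<psi>\<close> maps bijectively onto itself.\<close>

definition pperm_core :: "('x \<rightharpoonup> 'x) \<Rightarrow> 'x set" where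
  "pperm_core \<psi> = \<Union>{S. S \<subseteq> dom \<psi> \<and> bij_betw (\<lambda>x. the (\<psi> x)) S S}"

lemma pperm_core_greatest:
  assumes "inj_on \<psi> (dom \<psi>)"
  shows "pperm_core \<psi> = (GREATEST S. S \<subseteq> dom \<psi> \<and> bij_betw (\<lambda>x. the (\<psi> x)) S S)"
    and "pperm_core \<psi> \<subseteq> dom \<psi>"
    and "bij_betw (\<lambda>x. the (\<psi> x)) (pperm_core \<psi>) (pperm_core \<psi>)"
proof -
  let ?P = "\<lambda>S. S \<subseteq> dom \<psi> \<and> bij_betw (\<lambda>x. the (\<psi> x)) S S"
  show sub: "pperm_core \<psi> \<subseteq> dom \<psi>"
    by (auto simp: pperm_core_def)
  have "inj_on (\<lambda>x. the (\<psi> x)) (dom \<psi>)"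
    using assms by (auto simp: inj_on_def dom_def)
  then have inj: "inj_on (\<lambda>x. the (\<psi> x)) (pperm_core \<psi>)"
    using sub by (rule inj_on_subset)
  have "(\<lambda>x. the (\<psi> x)) ` pperm_core \<psi> = (\<Union>S\<in>{S. ?P S}. (\<lambda>x. the (\<psi> x)) ` S)"
    unfolding pperm_core_def by blast
  also have "\<dots> = (\<Union>S\<in>{S. ?P S}. S)"
    by (rule SUP_cong) (auto simp: bij_betw_def)
  finally have "(\<lambda>x. the (\<psi> x)) ` pperm_core \<psi> = pperm_core \<psi>"
    by (simp add: pperm_core_def)
  with inj show bij: "bij_betw (\<lambda>x. the (\<psi> x)) (pperm_core \<psi>) (pperm_core \<psi>)"
    by (simp add: bij_betw_def)
  show "pperm_core \<psi> = (GREATEST S. ?P S)"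
    by (rule Greatest_equality[symmetric]) (use sub bij in \<open>auto simp: pperm_core_def\<close>)
qed

definition pperm_cycles :: "('x \<rightharpoonup> 'x) \<Rightarrow> nat" where
  "pperm_cycles \<psi> = card (orbit (\<lambda>x. the (\<psi> x)) ` pperm_core \<psi>)"

definition ext_pperm ::
    "'b::comm_semiring_1 \<Rightarrow> ('x \<Rightarrow> 'b) \<Rightarrow> ('x \<Rightarrow> 'b) \<Rightarrow> 'x set \<Rightarrow> ('x \<Rightarrow> 'x \<Rightarrow> 'b) \<Rightarrow> 'b" where
  "ext_pperm \<beta> \<theta> \<phi> X M =
     (\<Sum>\<psi>\<in>partial_perms X. \<beta> ^ pperm_cycles \<psi> *
        (\<Prod>x\<in>dom \<psi>. M x (the (\<psi> x))) * (\<Prod>y\<in>X - ran \<psi>. \<theta> y) * (\<Prod>z\<in>X - dom \<psi>. \<phi> z))"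


section \<open>Block matrices with repeated indices\<close>

text \<open>\<open>Inl i'\<close> is the primed index \<open>i'\<close>, and \<open>Inr (i, a)\<close> is the copy \<open>i\<^sub>a\<close> of the index \<open>i\<close>.\<close>

definition block_index :: "('n \<Rightarrow> nat) \<Rightarrow> ('m + 'n \<times> nat) set" where
  "block_index r = range Inl \<union> Inr ` (SIGMA i:UNIV. {1..r i})"

fun block_matrix :: "'b^'m^'m \<Rightarrow> 'b^'n^'m \<Rightarrow> 'b^'m^'n \<Rightarrow> 'b^'n^'n \<Rightarrow>
    'm + 'n \<times> nat \<Rightarrow> 'm + 'n \<times> nat \<Rightarrow> 'b" where
  "block_matrix B U V A (Inl i) (Inl j) = B $ i $ j"
| "block_matrix B U V A (Inl i) (Inr (j, b)) = U $ i $ j"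
| "block_matrix B U V A (Inr (i, a)) (Inl j) = V $ i $ j"
| "block_matrix B U V A (Inr (i, a)) (Inr (j, b)) = A $ i $ j"

fun block_vector :: "'b^'m \<Rightarrow> 'b^'n \<Rightarrow> 'm + 'n \<times> nat \<Rightarrow> 'b" where
  "block_vector v' v (Inl i) = v' $ i"
| "block_vector v' v (Inr (i, a)) = v $ i"


section \<open>The indeterminates\<close>

datatype ('n, 'm) indet =
    X\<beta>
  | XA 'n 'n
  | XB 'm 'm
  | XU 'm 'n
  | XV 'n 'm
  | X\<theta> 'n
  | X\<phi> 'n
  | X\<theta>' 'm
  | X\<phi>' 'm

end

theory Submission
  imports Defs
begin

text \<open>The sum on the left is graded by \<open>r\<close>, and the proof compares it with the right-hand side degree by
  degree, through a recursion in \<open>r\<close> that both sides satisfy.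

  Let \<open>P r\<close> be the permanent on the left and let the multiplicity of an index \<open>i\<close> grow by one.
  In a partial permutation of the larger index set, the new copy \<open>x\<close> of \<open>i\<close> either is a component
  by itself, with weight \<open>c\<^sub>i = \<beta> A\<^sub>i\<^sub>i + \<theta>\<^sub>i \<phi>\<^sub>i\<close> (a loop or an isolated vertex), or it
  subdivides an arc \<open>y \<mapsto> z\<close> of a partial permutation of the smaller set, or it is put in front of
  the first vertex \<open>z\<close> of one of its paths, or behind the last vertex \<open>y\<close>. None of the last three
  operations changes the number of cycles. They replace one factor \<open>M\<^sub>y\<^sub>z\<close> by \<open>M\<^sub>y\<^sub>x M\<^sub>x\<^sub>z\<close>, one
  factor \<open>\<theta>\<^sub>z\<close> by \<open>\<theta>\<^sub>x M\<^sub>x\<^sub>z\<close>, or one factor \<open>\<phi>\<^sub>y\<close> by \<open>M\<^sub>y\<^sub>x \<phi>\<^sub>x\<close>; summed over all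
  factors, this is the product rule. Thus \<open>P (r + e\<^sub>i) = c\<^sub>i * P r + D\<^sub>i (P r)\<close>, where \<open>D\<^sub>i\<close> is the
  derivation of the ring of power series that makes these replacements on indeterminates
  (\<open>ext_pperm_insert\<close>, \<open>block_pperm_Suc\<close>).

  Give the indeterminates \<open>A\<^sub>i\<^sub>j\<close>, \<open>V\<^sub>i\<^sub>j\<close> and \<open>\<phi>\<^sub>i\<close> the degree \<open>e\<^sub>i\<close> and all others the degree zero,
  and let \<open>E\<^sub>i\<close> be the Euler operator that multiplies a monomial by the component \<open>i\<close> of its
  degree. As \<open>D\<^sub>i\<close> and \<open>c\<^sub>i\<close> raise the degree by \<open>e\<^sub>i\<close>, an equation \<open>E\<^sub>i R = c\<^sub>i R + D\<^sub>i R\<close> says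
  for the homogeneous parts of \<open>R\<close> that \<open>(r\<^sub>i + 1) R\<^sub>r\<^sub>+\<^sub>e = c\<^sub>i R\<^sub>r + D\<^sub>i R\<^sub>r\<close> with \<open>e = e\<^sub>i\<close>, which is
  the recursion of \<open>P r / r!\<close>. The right-hand side \<open>R\<close> satisfies it: the derivation
  \<open>E\<^sub>i - D\<^sub>i\<close> annihilates \<open>\<beta>\<close>, the modified matrix \<open>B + U (I - A)\<^sup>-\<^sup>1 V\<close> and the two modified
  vectors, hence also their permanent, and it maps the logarithm of \<open>det (I - A)\<^sup>-\<^sup>\<beta>\<close> to
  \<open>\<beta> A\<^sub>i\<^sub>i\<close> and the exponent \<open>\<theta> (I - A)\<^sup>-\<^sup>1 \<phi>\<^sup>T\<close> to \<open>\<theta>\<^sub>i \<phi>\<^sub>i\<close>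
  (\<open>delta_bilinear\<close>, \<open>derivation_log_det\<close>, \<open>delta_reduced_series\<close>). In degree zero both sides are the
  permanent of \<open>B\<close> with the primed vectors (\<open>homogeneous_part_reduced_series_0\<close>). So the permanents divided by
  \<open>r!\<close> are the homogeneous parts of \<open>R\<close>, and a series is the sum of its homogeneous
  parts.\<close>

section \<open>Partial permutations and their cores\<close>

lemma finite_partial_perms:
  assumes "finite X"
  shows "finite (partial_perms X)"
proof -
  have "partial_perms X \<subseteq> (\<Union>D\<in>Pow X. {\<psi>. dom \<psi> = D \<and> ran \<psi> \<subseteq> X})"
    by (auto simp: partial_perms_def)
  moreover have "finite (\<Union>D\<in>Pow X. {\<psi>::'a \<rightharpoonup> 'a. dom \<psi> = D \<and> ran \<psi> \<subseteq> X})"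
    using assms by (intro finite_UN_I) (auto intro: finite_set_of_finite_maps finite_subset)
  ultimately show ?thesis
    by (rule finite_subset)
qed

lemma partial_permD:
  assumes "\<psi> \<in> partial_perms X"
  shows "dom \<psi> \<subseteq> X" "ran \<psi> \<subseteq> X" "\<psi> a = Some c \<Longrightarrow> \<psi> b = Some c \<Longrightarrow> a = b"
    "inj_on \<psi> (dom \<psi>)" "inj_on (\<lambda>x. the (\<psi> x)) (dom \<psi>)"
    "\<psi> a = Some c \<Longrightarrow> a \<in> X" "\<psi> a = Some c \<Longrightarrow> c \<in> X"
  using assms unfolding partial_perms_def
  by (auto simp: inj_on_def dom_def ran_def)

lemma partial_permI:
  assumes "\<And>a b. \<psi> a = Some b \<Longrightarrow> a \<in> X \<and> b \<in> X"
    and "\<And>a b c. \<psi> a = Some c \<Longrightarrow> \<psi> b = Some c \<Longrightarrow> a = b"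
  shows "\<psi> \<in> partial_perms X"
  using assms unfolding partial_perms_def inj_on_def dom_def ran_def by fastforce

text \<open>A finite set that an injective map sends into itself is permuted by it, so membership in the
  core needs only a forward-closed set of defined points.\<close>

lemma pperm_core_iff:
  assumes "finite X" "\<psi> \<in> partial_perms X"
  shows "a \<in> pperm_core \<psi> \<longleftrightarrow> (\<exists>S\<subseteq>dom \<psi>. a \<in> S \<and> (\<forall>b\<in>S. the (\<psi> b) \<in> S))"
proof
  assume "a \<in> pperm_core \<psi>"
  then show "\<exists>S\<subseteq>dom \<psi>. a \<in> S \<and> (\<forall>b\<in>S. the (\<psi> b) \<in> S)"
    by (auto simp: pperm_core_def bij_betw_def)
next
  assume "\<exists>S\<subseteq>dom \<psi>. a \<in> S \<and> (\<forall>b\<in>S. the (\<psi> b) \<in> S)"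
  then obtain S where S: "S \<subseteq> dom \<psi>" "a \<in> S" "\<forall>b\<in>S. the (\<psi> b) \<in> S"
    by blast
  have "finite S"
    using S(1) partial_permD(1)[OF assms(2)] assms(1) by (meson finite_subset)
  moreover have inj: "inj_on (\<lambda>x. the (\<psi> x)) S"
    using partial_permD(5)[OF assms(2)] S(1) by (rule inj_on_subset)
  ultimately have "bij_betw (\<lambda>x. the (\<psi> x)) S S"
    using endo_inj_surj[of S "\<lambda>x. the (\<psi> x)"] S(3) by (auto simp: bij_betw_def)
  with S show "a \<in> pperm_core \<psi>"
    by (auto simp: pperm_core_def)
qed

lemma pperm_core_subset: "pperm_core \<psi> \<subseteq> dom \<psi>"
  by (auto simp: pperm_core_def)

lemma pperm_core_closed:
  assumes "a \<in> pperm_core \<psi>"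
  shows "the (\<psi> a) \<in> pperm_core \<psi>"
  using assms by (auto simp: pperm_core_def bij_betw_def)

lemma orbit_subset_closed:
  assumes "a \<in> S" "\<And>b. b \<in> S \<Longrightarrow> f b \<in> S"
  shows "orbit f a \<subseteq> S"
proof
  fix b assume "b \<in> orbit f a"
  then show "b \<in> S" by induction (use assms in auto)
qed

text \<open>Otherwise the map would send \<open>insert a O\<close>, where \<open>O\<close> is the orbit of \<open>a\<close>, injectively into
  the smaller finite set \<open>O\<close>.\<close>

lemma self_in_orbit_core:
  assumes "finite X" "\<psi> \<in> partial_perms X" "a \<in> pperm_core \<psi>"
  shows "a \<in> orbit (\<lambda>x. the (\<psi> x)) a"
proof -
  let ?f = "\<lambda>x. the (\<psi> x)"
  let ?O = "orbit ?f a"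
  have sub: "?O \<subseteq> pperm_core \<psi>"
    using assms(3) pperm_core_closed by (rule orbit_subset_closed)
  then have fin: "finite ?O"
    using pperm_core_subset[of \<psi>] partial_permD(1)[OF assms(2)] assms(1)
    by (meson finite_subset)
  have "inj_on ?f (insert a ?O)"
    using partial_permD(5)[OF assms(2)] by (rule inj_on_subset)
      (use sub assms(3) pperm_core_subset[of \<psi>] in auto)
  moreover have "?f ` insert a ?O \<subseteq> ?O"
    using orbit.base[of ?f a] orbit.step[of _ ?f a] by blast
  ultimately have "card (insert a ?O) \<le> card ?O"
    using card_inj_on_le fin by blast
  then show ?thesis using fin by (cases "a \<in> ?O") auto
qed

lemma pperm_cycles_cong:
  assumes "pperm_core \<psi>' = pperm_core \<psi>"
    and "\<And>a. a \<in> pperm_core \<psi> \<Longrightarrow> \<psi>' a = \<psi> a"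
  shows "pperm_cycles \<psi>' = pperm_cycles \<psi>"
proof -
  have "orbit (\<lambda>x. the (\<psi>' x)) a = orbit (\<lambda>x. the (\<psi> x)) a" if "a \<in> pperm_core \<psi>" for a
  proof (rule orbit_cong0[OF that])
    show "(\<lambda>x. the (\<psi>' x)) \<in> pperm_core \<psi> \<rightarrow> pperm_core \<psi>"
      using assms(2) pperm_core_closed[where \<psi> = \<psi>] by (simp add: Pi_iff)
  qed (use assms(2) in simp)
  then show ?thesis
    unfolding pperm_cycles_def assms(1) by (metis (no_types, lifting) image_cong)
qed

section \<open>Attaching one vertex to a partial permutation\<close>

context
  fixes X :: "'x set" and x :: 'x
  assumes fin: "finite X" and x: "x \<notin> X"
begin

lemma partial_perms_insert_mono: "\<psi> \<in> partial_perms X \<Longrightarrow> \<psi> \<in> partial_perms (insert x X)"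
  by (auto simp: partial_perms_def)

lemma new_vertex:
  assumes "\<psi> \<in> partial_perms X"
  shows "\<psi> x = None" "\<psi> a \<noteq> Some x" "x \<notin> dom \<psi>" "x \<notin> ran \<psi>"
proof -
  show "\<psi> x = None" using partial_permD(6)[OF assms, of x] x by (cases "\<psi> x") auto
  show "\<psi> a \<noteq> Some x" using partial_permD(7)[OF assms, of a x] x by auto
  show "x \<notin> dom \<psi>" "x \<notin> ran \<psi>" using partial_permD(1,2)[OF assms] x by auto
qed

lemma add_loop_partial_perm:
  assumes "\<psi> \<in> partial_perms X"
  shows "\<psi>(x \<mapsto> x) \<in> partial_perms (insert x X)"
  by (rule partial_permI)
    (use partial_permD[OF assms] new_vertex[OF assms] in \<open>auto split: if_splits\<close>)

lemma append_start_partial_perm: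
  assumes "\<psi> \<in> partial_perms X" "y \<in> X - ran \<psi>"
  shows "\<psi>(x \<mapsto> y) \<in> partial_perms (insert x X)"
  by (rule partial_permI)
    (use partial_permD[OF assms(1)] new_vertex[OF assms(1)] assms(2) in \<open>auto simp: ran_def split: if_splits\<close>)

lemma append_end_partial_perm:
  assumes "\<psi> \<in> partial_perms X" "y \<in> X - dom \<psi>"
  shows "\<psi>(y \<mapsto> x) \<in> partial_perms (insert x X)"
  by (rule partial_permI)
    (use partial_permD[OF assms(1)] new_vertex[OF assms(1)] assms(2) in \<open>auto split: if_splits\<close>)

lemma subdivide_arc_partial_perm:
  assumes "\<psi> \<in> partial_perms X" "\<psi> y = Some z"
  shows "\<psi>(y \<mapsto> x, x \<mapsto> z) \<in> partial_perms (insert x X)"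
  by (rule partial_permI)
    (use partial_permD[OF assms(1)] new_vertex[OF assms(1)] assms(2) in \<open>auto split: if_splits\<close>)

lemma cycles_add_loop:
  assumes "\<psi> \<in> partial_perms X"
  shows "pperm_cycles (\<psi>(x \<mapsto> x)) = Suc (pperm_cycles \<psi>)"
proof -
  let ?f = "\<lambda>a. the (\<psi> a)" and ?f' = "\<lambda>a. the ((\<psi>(x \<mapsto> x)) a)"
  have core: "pperm_core (\<psi>(x \<mapsto> x)) = insert x (pperm_core \<psi>)"
  proof (intro equalityI subsetI)
    fix a assume "a \<in> pperm_core (\<psi>(x \<mapsto> x))"
    then obtain S where S: "S \<subseteq> dom (\<psi>(x \<mapsto> x))" "a \<in> S" "\<forall>b\<in>S. ?f' b \<in> S"
      using pperm_core_iff[OF _ add_loop_partial_perm[OF assms]] fin by auto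
    have "\<forall>b\<in>S-{x}. the (\<psi> b) \<in> S-{x}"
    proof
      fix b assume b: "b \<in> S - {x}"
      then obtain c where "\<psi> b = Some c" using S by auto
      then show "the (\<psi> b) \<in> S-{x}"
        using b bspec[OF S(3), of b] new_vertex(2)[OF assms, of b] by auto
    qed
    then show "a \<in> insert x (pperm_core \<psi>)"
      using pperm_core_iff[OF fin assms, of a] S by (auto intro!: exI[of _ "S-{x}"])
  next
    fix a assume "a \<in> insert x (pperm_core \<psi>)"
    moreover have "\<forall>b\<in>insert x (pperm_core \<psi>). ?f' b \<in> insert x (pperm_core \<psi>)"
    proof
      fix b assume "b \<in> insert x (pperm_core \<psi>)"
      then show "?f' b \<in> insert x (pperm_core \<psi>)"
        using pperm_core_closed[of b \<psi>] by (cases "b = x") simp_all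
    qed
    moreover have "insert x (pperm_core \<psi>) \<subseteq> dom (\<psi>(x \<mapsto> x))"
      using pperm_core_subset[of \<psi>] by auto
    ultimately show "a \<in> pperm_core (\<psi>(x \<mapsto> x))"
      using pperm_core_iff[OF finite.insertI[OF fin] add_loop_partial_perm[OF assms]] by blast
  qed
  have xc: "x \<notin> pperm_core \<psi>"
    using pperm_core_subset[of \<psi>] new_vertex[OF assms] by auto
  have sub: "orbit ?f a \<subseteq> pperm_core \<psi>" if "a \<in> pperm_core \<psi>" for a
    using that pperm_core_closed by (rule orbit_subset_closed)
  have eq: "orbit ?f' a = orbit ?f a" if "a \<in> pperm_core \<psi>" for a
  proof (rule orbit_cong0[of _ "pperm_core \<psi>"])
    have "b \<noteq> x" if "b \<in> pperm_core \<psi>" for b using that xc by auto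
    then show "?f' \<in> pperm_core \<psi> \<rightarrow> pperm_core \<psi>"
      using pperm_core_closed[where \<psi> = \<psi>] by (simp add: Pi_iff)
  qed (use that xc in auto)
  have "x \<in> orbit ?f' x"
    using orbit.base[of ?f' x] by simp
  then have "orbit ?f' x \<notin> orbit ?f ` pperm_core \<psi>"
    using sub xc by blast
  moreover have "finite (pperm_core \<psi>)"
    using pperm_core_subset[of \<psi>] partial_permD(1)[OF assms] fin by (meson finite_subset)
  ultimately show ?thesis
    unfolding pperm_cycles_def core using eq by (simp cong: image_cong)
qed

text \<open>The new vertex has no predecessor, so it lies in no set that the map permutes; the families of
  such sets before and after the extension coincide.\<close>

lemma cycles_append_start:
  assumes "\<psi> \<in> partial_perms X" "y \<in> X - ran \<psi>"
  shows "pperm_cycles (\<psi>(x \<mapsto> y)) = pperm_cycles \<psi>"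
proof (rule pperm_cycles_cong)
  let ?\<psi>' = "\<psi>(x \<mapsto> y)"
  have bij: "S \<subseteq> dom ?\<psi>' \<and> bij_betw (\<lambda>a. the (?\<psi>' a)) S S
      \<longleftrightarrow> S \<subseteq> dom \<psi> \<and> bij_betw (\<lambda>a. the (\<psi> a)) S S" for S
  proof -
    have "x \<notin> S" if sub: "S \<subseteq> dom ?\<psi>'" and bij: "bij_betw (\<lambda>a. the (?\<psi>' a)) S S"
    proof
      assume "x \<in> S"
      then have "x \<in> (\<lambda>a. the (?\<psi>' a)) ` S"
        by (simp only: bij_betw_imp_surj_on[OF bij])
      then obtain b where b: "x = the (?\<psi>' b)" "b \<in> S"
        by (rule imageE)
      show False
      proof (cases "b = x")
        case True
        then have "x = y" using b(1) by simp
        then show False using assms(2) x by blast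
      next
        case False
        then have "b \<in> dom \<psi>" using subsetD[OF sub b(2)] by simp
        then obtain c where "\<psi> b = Some c" by auto
        then show False using False b(1) new_vertex(2)[OF assms(1), of b] by simp
      qed
    qed
    moreover have "bij_betw (\<lambda>a. the (?\<psi>' a)) S S \<longleftrightarrow> bij_betw (\<lambda>a. the (\<psi> a)) S S" if "x \<notin> S"
      by (rule bij_betw_cong) (use that in auto)
    moreover have "S \<subseteq> dom ?\<psi>' \<longleftrightarrow> S \<subseteq> dom \<psi>" if "x \<notin> S"
      using that by auto
    ultimately show ?thesis
      using new_vertex(3)[OF assms(1)] by blast
  qed
  show "pperm_core ?\<psi>' = pperm_core \<psi>"
    unfolding pperm_core_def bij ..
  show "?\<psi>' a = \<psi> a" if "a \<in> pperm_core \<psi>" for a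
    using that pperm_core_subset[of \<psi>] new_vertex(3)[OF assms(1)] by auto
qed

text \<open>Dually, the new vertex has no successor, hence neither it nor its predecessor \<open>y\<close> lies in a
  permuted set.\<close>

lemma cycles_append_end:
  assumes "\<psi> \<in> partial_perms X" "y \<in> X - dom \<psi>"
  shows "pperm_cycles (\<psi>(y \<mapsto> x)) = pperm_cycles \<psi>"
proof (rule pperm_cycles_cong)
  let ?\<psi>' = "\<psi>(y \<mapsto> x)"
  have bij: "S \<subseteq> dom ?\<psi>' \<and> bij_betw (\<lambda>a. the (?\<psi>' a)) S S
      \<longleftrightarrow> S \<subseteq> dom \<psi> \<and> bij_betw (\<lambda>a. the (\<psi> a)) S S" for S
  proof -
    have "y \<notin> S" if "S \<subseteq> dom ?\<psi>'" "bij_betw (\<lambda>a. the (?\<psi>' a)) S S"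
    proof
      assume "y \<in> S"
      then have "the (?\<psi>' y) \<in> S" using that(2) by (rule bij_betw_apply[rotated])
      then have "x \<in> S" by simp
      then show False using that(1) new_vertex[OF assms(1)] assms(2) x by auto
    qed
    moreover have "bij_betw (\<lambda>a. the (?\<psi>' a)) S S \<longleftrightarrow> bij_betw (\<lambda>a. the (\<psi> a)) S S" if "y \<notin> S"
      by (rule bij_betw_cong) (use that in auto)
    moreover have "S \<subseteq> dom ?\<psi>' \<longleftrightarrow> S \<subseteq> dom \<psi>" if "y \<notin> S"
      using that by auto
    ultimately show ?thesis
      using assms(2) by blast
  qed
  show "pperm_core ?\<psi>' = pperm_core \<psi>"
    unfolding pperm_core_def bij ..
  show "?\<psi>' a = \<psi> a" if "a \<in> pperm_core \<psi>" for a
    using that pperm_core_subset[of \<psi>] assms(2) by auto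
qed

text \<open>The orbit through \<open>y\<close>, if it is a cycle, gains the point \<open>x\<close>; all other orbits stay. Adding
  \<open>x\<close> to the orbit of \<open>y\<close> is injective on the old orbits, because none of them contains \<open>x\<close>.\<close>

lemma cycles_subdivide_arc:
  assumes "\<psi> \<in> partial_perms X" "\<psi> y = Some z"
  shows "pperm_cycles (\<psi>(y \<mapsto> x, x \<mapsto> z)) = pperm_cycles \<psi>"
proof -
  let ?\<psi>' = "\<psi>(y \<mapsto> x, x \<mapsto> z)"
  let ?f = "\<lambda>a. the (\<psi> a)" and ?f' = "\<lambda>a. the (?\<psi>' a)" and ?C = "pperm_core \<psi>"
  let ?sub = "\<lambda>S. if y \<in> S then insert x S else S"
  note iff' = pperm_core_iff[OF finite.insertI[OF fin] subdivide_arc_partial_perm[OF assms]]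
  have xy: "x \<noteq> y" "x \<noteq> z" "y \<in> dom \<psi>"
    using new_vertex[OF assms(1)] assms(2) by auto
  have xC: "x \<notin> ?C"
    using pperm_core_subset[of \<psi>] new_vertex[OF assms(1)] by auto
  have core: "pperm_core ?\<psi>' = ?sub ?C"
  proof (intro equalityI subsetI)
    fix a assume "a \<in> pperm_core ?\<psi>'"
    then obtain S where S: "S \<subseteq> dom ?\<psi>'" "a \<in> S" "\<forall>b\<in>S. ?f' b \<in> S"
      using iff' by auto
    have cl: "\<forall>b\<in>S-{x}. ?f b \<in> S-{x}"
    proof
      fix b assume b: "b \<in> S - {x}"
      then obtain c where c: "\<psi> b = Some c" using S xy by auto
      then have "c \<noteq> x" using new_vertex(2)[OF assms(1), of b] by auto
      show "?f b \<in> S-{x}"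
      proof (cases "b = y")
        case True
        then have "x \<in> S" using b S(3) xy by force
        then have "z \<in> S" using S(3) by force
        then show ?thesis using True assms(2) xy by auto
      next
        case False
        then show ?thesis using b bspec[OF S(3), of b] c \<open>c \<noteq> x\<close> by auto
      qed
    qed
    have sub: "S - {x} \<subseteq> dom \<psi>" using S xy by auto
    show "a \<in> ?sub ?C"
    proof (cases "a = x")
      case False
      then have "a \<in> ?C"
        using pperm_core_iff[OF fin assms(1), of a] S(2) cl sub by (auto intro!: exI[of _ "S-{x}"])
      then show ?thesis by auto
    next
      case True
      then have "z \<in> S - {x}" using S(2,3) xy by force
      then have "y \<in> ?C"
        \<comment> \<open>A closed set that contains \<open>z\<close> remains closed when its predecessor \<open>y\<close> is added.\<close>
        using pperm_core_iff[OF fin assms(1), of y] cl sub xy assms(2)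
        by (auto intro!: exI[of _ "insert y (S-{x})"])
      then show ?thesis using True by auto
    qed
  next
    fix a assume a: "a \<in> ?sub ?C"
    have "\<forall>b\<in>?sub ?C. ?f' b \<in> ?sub ?C"
    proof
      fix b assume b: "b \<in> ?sub ?C"
      show "?f' b \<in> ?sub ?C"
      proof (cases "b = x")
        case True
        then have "y \<in> ?C" using b xC by (auto split: if_splits)
        then have "z \<in> ?C" using pperm_core_closed[of y \<psi>] assms(2) by simp
        then show ?thesis using True by simp
      next
        case False
        then have bC: "b \<in> ?C" using b by (auto split: if_splits)
        show ?thesis
        proof (cases "b = y")
          case True
          then show ?thesis using bC xy by simp
        next
          case not_y: False
          then show ?thesis using False pperm_core_closed[OF bC] by simp
        qed
      qed
    qed
    moreover have "?sub ?C \<subseteq> dom ?\<psi>'" using pperm_core_subset[of \<psi>] by auto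
    ultimately show "a \<in> pperm_core ?\<psi>'"
      using a iff' by blast
  qed
  have sub: "orbit ?f a \<subseteq> ?C" if "a \<in> ?C" for a
    using that pperm_core_closed by (rule orbit_subset_closed)
  define f' where "f' = ?f'"
  have f'x: "f' x = z" and f'y: "f' y = x" and f'b: "\<And>b. b \<noteq> x \<Longrightarrow> b \<noteq> y \<Longrightarrow> f' b = ?f b"
    using xy by (simp_all add: f'_def)
  have orb: "orbit f' a = ?sub (orbit ?f a)" if a: "a \<in> ?C" for a
  proof (intro equalityI subsetI)
    have x': "b \<noteq> x" if "b \<in> orbit ?f a" for b using that sub[OF a] xC by auto
    have ax: "a \<noteq> x" using a xC by auto
    show "b \<in> ?sub (orbit ?f a)" if "b \<in> orbit f' a" for b
      using that
    proof induction
      case base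
      then show ?case
      proof (cases "a = y")
        case True
        then have "y \<in> orbit ?f a"
          using self_in_orbit_core[OF fin assms(1) a] by simp
        then show ?thesis using True f'x f'y f'b xy by simp
      next
        case False
        then show ?thesis using f'b ax orbit.base[of ?f a] by simp
      qed
    next
      case (step b)
      show ?case
      proof (cases "b = x")
        case True
        then have "y \<in> orbit ?f a" using step.IH x' by (auto split: if_splits)
        then have "z \<in> orbit ?f a" using orbit.step[of y ?f a] assms(2) by simp
        then show ?thesis using True f'x by simp
      next
        case False
        then have b: "b \<in> orbit ?f a" using step.IH by (auto split: if_splits)
        show ?thesis
        proof (cases "b = y")
          case True
          then show ?thesis using b f'x f'y f'b xy by simp
        next
          case not_y: False
          then show ?thesis using orbit.step[OF b] False not_y f'b by simp
        qed
      qed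
    qed
    have *: "b \<in> orbit f' a" if "b \<in> orbit ?f a" for b
      using that
    proof induction
      case base
      show ?case
      proof (cases "a = y")
        case True
        have "f' (f' a) \<in> orbit f' a" by (rule orbit.step[OF orbit.base])
        moreover have "f' (f' a) = ?f a" using True f'x f'y f'b xy assms(2) by simp
        ultimately show ?thesis by simp
      next
        case False
        then show ?thesis using f'b ax orbit.base[of f' a] by simp
      qed
    next
      case (step b)
      show ?case
      proof (cases "b = y")
        case True
        then show ?thesis using orbit.step[OF orbit.step[OF step(2)]] f'x f'y f'b xy assms(2) by simp
      next
        case False
        then show ?thesis using f'b x'[OF step(1)] orbit.step[OF step(2)] by simp
      qed
    qed
    show "b \<in> orbit f' a" if "b \<in> ?sub (orbit ?f a)" for b
    proof (cases "b = x")
      case True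
      then have "y \<in> orbit ?f a" using that x' by (auto split: if_splits)
      then show ?thesis using orbit.step[OF *[of y]] True f'x f'y f'b xy by simp
    next
      case False
      then show ?thesis using that * by (auto split: if_splits)
    qed
  qed
  have inj: "inj_on ?sub (orbit ?f ` ?C)"
  proof (rule inj_onI)
    fix O1 O2 assume "O1 \<in> orbit ?f ` ?C" "O2 \<in> orbit ?f ` ?C" and eq: "?sub O1 = ?sub O2"
    then have "x \<notin> O1" "x \<notin> O2" using sub xC by auto
    then show "O1 = O2" using eq by (auto split: if_splits)
  qed
  have "orbit f' ` pperm_core ?\<psi>' = ?sub ` (orbit ?f ` ?C)"
  proof (cases "y \<in> ?C")
    case True
    have "x \<in> orbit f' y"
      using orbit.base[of f' y] f'y by simp
    moreover have "y \<in> orbit f' x"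
      using orbit_step[of y f' y] orb[OF True] self_in_orbit_core[OF fin assms(1) True] f'y xy by simp
    ultimately have "orbit f' x = orbit f' y"
      using orbit_trans[of _ f' x y] orbit_trans[of _ f' y x] by auto
    then have "orbit f' ` insert x ?C = orbit f' ` ?C"
      using True by auto
    also have "\<dots> = ?sub ` (orbit ?f ` ?C)"
      unfolding image_image by (rule image_cong[OF refl orb])
    finally show ?thesis
      unfolding core using True by simp
  next
    case False
    then have "orbit f' ` pperm_core ?\<psi>' = orbit f' ` ?C"
      unfolding core by simp
    also have "\<dots> = ?sub ` (orbit ?f ` ?C)"
      unfolding image_image by (rule image_cong[OF refl orb])
    finally show ?thesis .
  qed
  then show ?thesis
    unfolding pperm_cycles_def f'_def[symmetric] using card_image[OF inj] by simp
qed

end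

section \<open>Derivations and the permanent with one more index\<close>

locale derivation =
  fixes d :: "'b::comm_ring_1 \<Rightarrow> 'b"
  assumes add: "d (x + y) = d x + d y"
    and mult: "d (x * y) = d x * y + x * d y"
begin

lemma zero: "d 0 = 0"
  using add[of 0 0] by simp

lemma one: "d 1 = 0"
  using mult[of 1 1] by simp

lemma sum: "d (\<Sum>i\<in>I. f i) = (\<Sum>i\<in>I. d (f i))"
  by (induction I rule: infinite_finite_induct) (simp_all add: zero add)

lemma prod:
  assumes "finite I"
  shows "d (\<Prod>i\<in>I. f i) = (\<Sum>i\<in>I. d (f i) * (\<Prod>j\<in>I - {i}. f j))"
  using assms
proof (induction I)
  case empty
  then show ?case by (simp add: one)
next
  case (insert a I)
  have "(\<Prod>j\<in>insert a I - {i}. f j) = f a * (\<Prod>j\<in>I - {i}. f j)" if "i \<in> I" for i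
  proof -
    have "insert a I - {i} = insert a (I - {i})"
      using that insert.hyps by auto
    then show ?thesis using insert.hyps by simp
  qed
  then show ?case
    using insert by (simp add: mult sum_distrib_left ac_simps)
qed

lemma prod_zero: "(\<And>i. i \<in> I \<Longrightarrow> d (f i) = 0) \<Longrightarrow> d (\<Prod>i\<in>I. f i) = 0"
  by (induction I rule: infinite_finite_induct) (simp_all add: one mult)

lemma power: "d (x ^ Suc k) = of_nat (Suc k) * x ^ k * d x"
  by (induction k) (simp_all add: mult one algebra_simps)

lemma power_zero: "d x = 0 \<Longrightarrow> d (x ^ k) = 0"
  by (induction k) (simp_all add: one mult)

end

definition pperm_term ::
    "'b::comm_semiring_1 \<Rightarrow> ('x \<Rightarrow> 'b) \<Rightarrow> ('x \<Rightarrow> 'b) \<Rightarrow> 'x set \<Rightarrow> ('x \<Rightarrow> 'x \<Rightarrow> 'b) \<Rightarrow> ('x \<rightharpoonup> 'x) \<Rightarrow> 'b" where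
  "pperm_term \<beta> \<theta> \<phi> X M \<psi> = \<beta> ^ pperm_cycles \<psi> *
     (\<Prod>x\<in>dom \<psi>. M x (the (\<psi> x))) * (\<Prod>y\<in>X - ran \<psi>. \<theta> y) * (\<Prod>z\<in>X - dom \<psi>. \<phi> z)"

lemma ext_pperm_eq_sum_terms:
  "ext_pperm \<beta> \<theta> \<phi> X M = (\<Sum>\<psi>\<in>partial_perms X. pperm_term \<beta> \<theta> \<phi> X M \<psi>)"
  by (simp add: ext_pperm_def pperm_term_def)

lemma (in derivation) ext_pperm_zero:
  assumes "d \<beta> = 0"
    and "\<And>x y. x \<in> X \<Longrightarrow> y \<in> X \<Longrightarrow> d (M x y) = 0"
    and "\<And>x. x \<in> X \<Longrightarrow> d (\<theta> x) = 0" "\<And>x. x \<in> X \<Longrightarrow> d (\<phi> x) = 0"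
  shows "d (ext_pperm \<beta> \<theta> \<phi> X M) = 0"
  unfolding ext_pperm_def sum
proof (rule sum.neutral, rule ballI)
  fix \<psi> assume "\<psi> \<in> partial_perms X"
  note \<psi> = partial_permD[OF this]
  have "d (\<Prod>x\<in>dom \<psi>. M x (the (\<psi> x))) = 0"
    by (rule prod_zero) (use \<psi>(6,7) assms(2) in auto)
  moreover have "d (\<Prod>y\<in>X - ran \<psi>. \<theta> y) = 0" "d (\<Prod>z\<in>X - dom \<psi>. \<phi> z) = 0"
    by (rule prod_zero; use assms in simp)+
  ultimately show "d (\<beta> ^ pperm_cycles \<psi> * (\<Prod>x\<in>dom \<psi>. M x (the (\<psi> x))) *
      (\<Prod>y\<in>X - ran \<psi>. \<theta> y) * (\<Prod>z\<in>X - dom \<psi>. \<phi> z)) = 0"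
    by (simp add: mult power_zero assms(1))
qed

text \<open>A new vertex \<open>x\<close> is a fixed point, or isolated (neither in the domain nor in the image), or the
  interior of an arc \<open>y \<mapsto> x \<mapsto> z\<close>, or the first or the last vertex of a path with at least one
  arc. Contracting \<open>x\<close> leaves a partial permutation of the old set together with the arc
  that was subdivided, or the vertex to which \<open>x\<close> was attached.\<close>

lemma sum_partial_perms_insert:
  fixes g :: "('x \<rightharpoonup> 'x) \<Rightarrow> 'b::comm_monoid_add"
  assumes fin: "finite X" and x: "x \<notin> X"
  shows "(\<Sum>\<psi>\<in>partial_perms (insert x X). g \<psi>) =
    (\<Sum>\<psi>\<in>partial_perms X.
      g (\<psi>(x \<mapsto> x)) + g \<psi> + (\<Sum>y\<in>dom \<psi>. g (\<psi>(y \<mapsto> x, x \<mapsto> the (\<psi> y))))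
      + (\<Sum>z\<in>X - ran \<psi>. g (\<psi>(x \<mapsto> z))) + (\<Sum>y\<in>X - dom \<psi>. g (\<psi>(y \<mapsto> x))))"
proof -
  let ?P = "partial_perms X" and ?P' = "partial_perms (insert x X)"
  note new = new_vertex[OF fin x]
  have finP: "finite ?P" using fin by (rule finite_partial_perms)
  have finP': "finite ?P'" using fin by (intro finite_partial_perms) simp
  let ?loop = "{\<psi>\<in>?P'. \<psi> x = Some x}"
  let ?iso = "{\<psi>\<in>?P'. \<psi> x = None \<and> x \<notin> ran \<psi>}"
  let ?arc = "{\<psi>\<in>?P'. \<psi> x \<noteq> None \<and> \<psi> x \<noteq> Some x \<and> x \<in> ran \<psi>}"
  let ?start = "{\<psi>\<in>?P'. \<psi> x \<noteq> None \<and> \<psi> x \<noteq> Some x \<and> x \<notin> ran \<psi>}"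
  let ?end = "{\<psi>\<in>?P'. \<psi> x = None \<and> x \<in> ran \<psi>}"
  have "(\<Sum>\<psi>\<in>?loop. g \<psi>) = (\<Sum>\<psi>\<in>?P. g (\<psi>(x \<mapsto> x)))"
  proof (rule sum.reindex_bij_witness[of _ "\<lambda>\<psi>. \<psi>(x \<mapsto> x)" "\<lambda>\<psi>. \<psi>(x := None)"])
    fix \<psi> assume \<psi>: "\<psi> \<in> ?loop"
    then have P': "\<psi> \<in> ?P'" by simp
    show "\<psi>(x := None) \<in> ?P"
    proof (rule partial_permI)
      fix a b c
      show "a \<in> X \<and> b \<in> X" if "(\<psi>(x := None)) a = Some b"
        using that partial_permD(6,7)[OF P', of a b] partial_permD(3)[OF P', of x x a] \<psi>
        by (auto split: if_splits)
      show "a = b" if "(\<psi>(x := None)) a = Some c" "(\<psi>(x := None)) b = Some c"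
        using that partial_permD(3)[OF P', of a c b] by (auto split: if_splits)
    qed
    show "(\<psi>(x := None))(x \<mapsto> x) = \<psi>" using \<psi> by auto
    then show "g ((\<psi>(x := None))(x \<mapsto> x)) = g \<psi>" by simp
  next
    fix \<psi> assume \<psi>: "\<psi> \<in> ?P"
    show "\<psi>(x \<mapsto> x) \<in> ?loop" using add_loop_partial_perm[OF fin x \<psi>] by simp
    show "(\<psi>(x \<mapsto> x))(x := None) = \<psi>" using new[OF \<psi>] by auto
  qed
  moreover have "?iso = ?P"
  proof (intro equalityI subsetI)
    fix \<psi> assume \<psi>: "\<psi> \<in> ?iso"
    then have P': "\<psi> \<in> ?P'" by simp
    have "a \<in> X \<and> b \<in> X" if "\<psi> a = Some b" for a b
      using partial_permD(6,7)[OF P' that] that \<psi> by (auto simp: ran_def)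
    then show "\<psi> \<in> ?P"
      using partial_permD(3)[OF P'] by (intro partial_permI) auto
  next
    fix \<psi> assume "\<psi> \<in> ?P"
    then show "\<psi> \<in> ?iso" using new(1,4) partial_perms_insert_mono[OF fin x] by simp
  qed
  moreover have "(\<Sum>\<psi>\<in>?arc. g \<psi>) = (\<Sum>\<psi>\<in>?P. \<Sum>y\<in>dom \<psi>. g (\<psi>(y \<mapsto> x, x \<mapsto> the (\<psi> y))))"
  proof -
    let ?h = "\<lambda>(\<psi>, y). \<psi>(y \<mapsto> x, x \<mapsto> the (\<psi> y))"
    have inj: "inj_on ?h (SIGMA \<psi>:?P. dom \<psi>)"
    proof (rule inj_onI, clarsimp)
      fix \<psi> \<psi>' y y' z z'
      assume \<psi>: "\<psi> \<in> ?P" "\<psi>' \<in> ?P" "\<psi> y = Some z" "\<psi>' y' = Some z'"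
        and eq: "\<psi>(y \<mapsto> x, x \<mapsto> z) = \<psi>'(y' \<mapsto> x, x \<mapsto> z')"
      have ne: "y \<noteq> x" "y' \<noteq> x" using \<psi> new(1) by fastforce+
      have yy: "y = y'"
        using fun_cong[OF eq, of y] ne new(2)[OF \<psi>(2), of y] by (auto split: if_splits)
      have "\<psi> a = \<psi>' a" for a
        using fun_cong[OF eq, of a] fun_cong[OF eq, of x] \<psi>(3,4) yy new(1)[OF \<psi>(1)] new(1)[OF \<psi>(2)]
        by (cases "a = x"; cases "a = y") auto
      then show "\<psi> = \<psi>' \<and> y = y'" using yy by blast
    qed
    have im: "?h ` (SIGMA \<psi>:?P. dom \<psi>) = ?arc"
    proof (intro equalityI subsetI)
      fix \<rho> assume "\<rho> \<in> ?h ` (SIGMA \<psi>:?P. dom \<psi>)"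
      then obtain \<psi> y z where \<psi>: "\<psi> \<in> ?P" "\<psi> y = Some z" "\<rho> = \<psi>(y \<mapsto> x, x \<mapsto> z)"
        by auto
      have "y \<noteq> x" "z \<noteq> x" using \<psi> new(1,2)[OF \<psi>(1)] by auto
      moreover from \<open>y \<noteq> x\<close> have "x \<in> ran \<rho>"
        unfolding \<psi>(3) ran_def by auto
      ultimately show "\<rho> \<in> ?arc"
        using subdivide_arc_partial_perm[OF fin x \<psi>(1,2)] \<psi>(3) by simp
    next
      fix \<rho> assume \<rho>: "\<rho> \<in> ?arc"
      then have P': "\<rho> \<in> ?P'" by simp
      from \<rho> obtain z where z: "\<rho> x = Some z" "z \<noteq> x" by auto
      from \<rho> obtain y where y: "\<rho> y = Some x" by (auto simp: ran_def)
      have ne: "y \<noteq> x" using y z by auto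
      let ?\<psi> = "\<rho>(x := None, y \<mapsto> z)"
      have zu: "a = x" if "\<rho> a = Some z" for a using partial_permD(3)[OF P' that z(1)] .
      have xu: "a = y" if "\<rho> a = Some x" for a using partial_permD(3)[OF P' that y] .
      have "?\<psi> \<in> ?P"
      proof (rule partial_permI)
        fix a b c
        show "a \<in> X \<and> b \<in> X" if "?\<psi> a = Some b"
          using that partial_permD(6,7)[OF P'] xu[of a] y z ne by (auto split: if_splits)
        show "a = b" if "?\<psi> a = Some c" "?\<psi> b = Some c"
          using that partial_permD(3)[OF P', of a c b] zu by (auto split: if_splits)
      qed
      moreover have "?\<psi>(y \<mapsto> x, x \<mapsto> the (?\<psi> y)) = \<rho>"
        using y z ne by auto
      ultimately show "\<rho> \<in> ?h ` (SIGMA \<psi>:?P. dom \<psi>)"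
        by (intro image_eqI[of _ _ "(?\<psi>, y)"]) auto
    qed
    have "(\<Sum>\<psi>\<in>?arc. g \<psi>) = (\<Sum>p\<in>(SIGMA \<psi>:?P. dom \<psi>). g (?h p))"
      unfolding im[symmetric] by (subst sum.reindex[OF inj]) simp
    also have "\<dots> = (\<Sum>\<psi>\<in>?P. \<Sum>y\<in>dom \<psi>. g (\<psi>(y \<mapsto> x, x \<mapsto> the (\<psi> y))))"
      by (subst sum.Sigma[OF finP])
        (use finite_subset[OF partial_permD(1) fin] in \<open>auto simp: case_prod_unfold\<close>)
    finally show ?thesis .
  qed
  moreover have "(\<Sum>\<psi>\<in>?start. g \<psi>) = (\<Sum>\<psi>\<in>?P. \<Sum>z\<in>X - ran \<psi>. g (\<psi>(x \<mapsto> z)))"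
  proof -
    have "(\<Sum>\<psi>\<in>?start. g \<psi>) = (\<Sum>(\<psi>, z)\<in>(SIGMA \<psi>:?P. X - ran \<psi>). g (\<psi>(x \<mapsto> z)))"
    proof (rule sum.reindex_bij_witness[of _ "\<lambda>(\<psi>, z). \<psi>(x \<mapsto> z)" "\<lambda>\<psi>. (\<psi>(x := None), the (\<psi> x))"])
      fix \<rho> assume \<rho>: "\<rho> \<in> ?start"
      then have P': "\<rho> \<in> ?P'" by simp
      from \<rho> obtain z where z: "\<rho> x = Some z" "z \<noteq> x" by auto
      have nr: "\<rho> a \<noteq> Some x" for a using \<rho> by (auto simp: ran_def)
      have zu: "a = x" if "\<rho> a = Some z" for a using partial_permD(3)[OF P' that z(1)] .
      have "\<rho>(x := None) \<in> ?P"
      proof (rule partial_permI)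
        fix a b c
        show "a \<in> X \<and> b \<in> X" if "(\<rho>(x := None)) a = Some b"
          using that partial_permD(6,7)[OF P', of a b] nr[of a] by (auto split: if_splits)
        show "a = b" if "(\<rho>(x := None)) a = Some c" "(\<rho>(x := None)) b = Some c"
          using that partial_permD(3)[OF P', of a c b] by (auto split: if_splits)
      qed
      moreover have "z \<in> X" using partial_permD(7)[OF P' z(1)] z(2) by simp
      moreover have "z \<notin> ran (\<rho>(x := None))" using zu by (auto simp: ran_def)
      ultimately show "(\<rho>(x := None), the (\<rho> x)) \<in> (SIGMA \<psi>:?P. X - ran \<psi>)"
        using z by simp
      show "(case (\<rho>(x := None), the (\<rho> x)) of (\<psi>, z) \<Rightarrow> \<psi>(x \<mapsto> z)) = \<rho>"
        using z by auto
      then show "(case (\<rho>(x := None), the (\<rho> x)) of (\<psi>, z) \<Rightarrow> g (\<psi>(x \<mapsto> z))) = g \<rho>"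
        by simp
    next
      fix p assume "p \<in> (SIGMA \<psi>:?P. X - ran \<psi>)"
      then obtain \<psi> z where p: "p = (\<psi>, z)" "\<psi> \<in> ?P" "z \<in> X - ran \<psi>" by auto
      have "x \<notin> ran (\<psi>(x \<mapsto> z))" using p x new[OF p(2)] by (auto simp: ran_def)
      moreover have "z \<noteq> x" using p x by auto
      ultimately show "(case p of (\<psi>, z) \<Rightarrow> \<psi>(x \<mapsto> z)) \<in> ?start"
        using append_start_partial_perm[OF fin x p(2,3)] p by simp
      have "\<psi>(x := None) = \<psi>" using new(1)[OF p(2)] by auto
      then show "((case p of (\<psi>, z) \<Rightarrow> \<psi>(x \<mapsto> z))(x := None), the ((case p of (\<psi>, z) \<Rightarrow> \<psi>(x \<mapsto> z)) x)) = p"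
        using p by simp
    qed
    also have "\<dots> = (\<Sum>\<psi>\<in>?P. \<Sum>z\<in>X - ran \<psi>. g (\<psi>(x \<mapsto> z)))"
      by (subst sum.Sigma[OF finP]) (use fin in auto)
    finally show ?thesis .
  qed
  moreover have "(\<Sum>\<psi>\<in>?end. g \<psi>) = (\<Sum>\<psi>\<in>?P. \<Sum>y\<in>X - dom \<psi>. g (\<psi>(y \<mapsto> x)))"
  proof -
    let ?h = "\<lambda>(\<psi>, y). \<psi>(y \<mapsto> x)"
    have inj: "inj_on ?h (SIGMA \<psi>:?P. X - dom \<psi>)"
    proof (rule inj_onI)
      fix p p'
      assume p: "p \<in> (SIGMA \<psi>:?P. X - dom \<psi>)" "p' \<in> (SIGMA \<psi>:?P. X - dom \<psi>)" "?h p = ?h p'"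
      obtain \<psi> y \<psi>' y' where pp: "p = (\<psi>, y)" "p' = (\<psi>', y')" by (cases p, cases p')
      have \<psi>: "\<psi> \<in> ?P" "\<psi>' \<in> ?P" "y \<notin> dom \<psi>" "y' \<notin> dom \<psi>'"
        and eq: "\<psi>(y \<mapsto> x) = \<psi>'(y' \<mapsto> x)"
        using p unfolding pp by auto
      have yy: "y = y'"
        using fun_cong[OF eq, of y] new(2)[OF \<psi>(2), of y] by (auto split: if_splits)
      have "\<psi> a = \<psi>' a" for a
        using fun_cong[OF eq, of a] \<psi>(3,4) yy by (cases "a = y") (auto simp: domIff)
      then show "p = p'" using yy unfolding pp by blast
    qed
    have im: "?h ` (SIGMA \<psi>:?P. X - dom \<psi>) = ?end"
    proof (intro equalityI subsetI)
      fix \<rho> assume "\<rho> \<in> ?h ` (SIGMA \<psi>:?P. X - dom \<psi>)"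
      then obtain \<psi> y where \<psi>: "\<psi> \<in> ?P" "y \<in> X - dom \<psi>" "\<rho> = \<psi>(y \<mapsto> x)"
        by auto
      have "y \<noteq> x" using \<psi>(2) x by auto
      moreover have "x \<in> ran \<rho>"
        unfolding \<psi>(3) ran_def by auto
      ultimately show "\<rho> \<in> ?end"
        using append_end_partial_perm[OF fin x \<psi>(1,2)] \<psi>(3) new(1)[OF \<psi>(1)] by simp
    next
      fix \<rho> assume \<rho>: "\<rho> \<in> ?end"
      then have P': "\<rho> \<in> ?P'" and xN: "\<rho> x = None" by simp_all
      from \<rho> obtain y where y: "\<rho> y = Some x" by (auto simp: ran_def)
      have ne: "y \<noteq> x" using y xN by auto
      let ?\<psi> = "\<rho>(y := None)"
      have xu: "a = y" if "\<rho> a = Some x" for a using partial_permD(3)[OF P' that y] .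
      have "?\<psi> \<in> ?P"
      proof (rule partial_permI)
        fix a b c
        show "a \<in> X \<and> b \<in> X" if "?\<psi> a = Some b"
          using that partial_permD(6,7)[OF P', of a b] xu[of a] xN by (auto split: if_splits)
        show "a = b" if "?\<psi> a = Some c" "?\<psi> b = Some c"
          using that partial_permD(3)[OF P', of a c b] by (auto split: if_splits)
      qed
      moreover have "y \<in> X" using partial_permD(6)[OF P' y] ne by simp
      moreover have "?\<psi>(y \<mapsto> x) = \<rho>"
        using y by auto
      ultimately show "\<rho> \<in> ?h ` (SIGMA \<psi>:?P. X - dom \<psi>)"
        by (intro image_eqI[of _ _ "(?\<psi>, y)"]) auto
    qed
    have "(\<Sum>\<psi>\<in>?end. g \<psi>) = (\<Sum>p\<in>(SIGMA \<psi>:?P. X - dom \<psi>). g (?h p))"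
      unfolding im[symmetric] by (subst sum.reindex[OF inj]) simp
    also have "\<dots> = (\<Sum>\<psi>\<in>?P. \<Sum>y\<in>X - dom \<psi>. g (\<psi>(y \<mapsto> x)))"
      by (subst sum.Sigma[OF finP]) (use fin in \<open>auto simp: case_prod_unfold\<close>)
    finally show ?thesis .
  qed
  moreover have "(\<Sum>\<psi>\<in>?P'. g \<psi>) = (\<Sum>\<psi>\<in>?loop. g \<psi>) + (\<Sum>\<psi>\<in>?iso. g \<psi>) + (\<Sum>\<psi>\<in>?arc. g \<psi>)
      + (\<Sum>\<psi>\<in>?start. g \<psi>) + (\<Sum>\<psi>\<in>?end. g \<psi>)"
  proof -
    have "?P' = ?loop \<union> ?iso \<union> ?arc \<union> ?start \<union> ?end"
      by (rule set_eqI) (simp only: Un_iff mem_Collect_eq, argo)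
    then have "(\<Sum>\<psi>\<in>?P'. g \<psi>) = (\<Sum>\<psi>\<in>?loop \<union> ?iso \<union> ?arc \<union> ?start \<union> ?end. g \<psi>)"
      by (rule arg_cong)
    also have "\<dots> = (\<Sum>\<psi>\<in>?loop \<union> ?iso \<union> ?arc \<union> ?start. g \<psi>) + (\<Sum>\<psi>\<in>?end. g \<psi>)"
      by (rule sum.union_disjoint) (use finP' in auto)
    also have "(\<Sum>\<psi>\<in>?loop \<union> ?iso \<union> ?arc \<union> ?start. g \<psi>)
        = (\<Sum>\<psi>\<in>?loop \<union> ?iso \<union> ?arc. g \<psi>) + (\<Sum>\<psi>\<in>?start. g \<psi>)"
      by (rule sum.union_disjoint) (use finP' in auto)
    also have "(\<Sum>\<psi>\<in>?loop \<union> ?iso \<union> ?arc. g \<psi>) = (\<Sum>\<psi>\<in>?loop \<union> ?iso. g \<psi>) + (\<Sum>\<psi>\<in>?arc. g \<psi>)"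
      by (rule sum.union_disjoint) (use finP' in auto)
    also have "(\<Sum>\<psi>\<in>?loop \<union> ?iso. g \<psi>) = (\<Sum>\<psi>\<in>?loop. g \<psi>) + (\<Sum>\<psi>\<in>?iso. g \<psi>)"
      by (rule sum.union_disjoint) (use finP' in auto)
    finally show ?thesis .
  qed
  ultimately show ?thesis
    by (simp only: sum.distrib)
qed

text \<open>The derivation \<open>d\<close> replaces one factor of a term at a time. Replacing \<open>M y z\<close> by
  \<open>M y x * M x z\<close> is the effect of subdividing the arc from \<open>y\<close> to \<open>z\<close>; replacing
  \<open>\<theta> z\<close> by \<open>\<theta> x * M x z\<close> is the effect of starting the path of \<open>z\<close> at \<open>x\<close>; and replacing
  \<open>\<phi> y\<close> by \<open>M y x * \<phi> x\<close> is that of ending the path of \<open>y\<close> at \<open>x\<close>. Loop and isolated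
  vertex give the factor in front.\<close>

theorem (in derivation) ext_pperm_insert:
  assumes fin: "finite X" and x: "x \<notin> X"
    and d\<beta>: "d \<beta> = 0"
    and dM: "\<And>y z. y \<in> X \<Longrightarrow> z \<in> X \<Longrightarrow> d (M y z) = M y x * M x z"
    and d\<theta>: "\<And>z. z \<in> X \<Longrightarrow> d (\<theta> z) = \<theta> x * M x z"
    and d\<phi>: "\<And>y. y \<in> X \<Longrightarrow> d (\<phi> y) = M y x * \<phi> x"
  shows "ext_pperm \<beta> \<theta> \<phi> (insert x X) M =
    (\<beta> * M x x + \<theta> x * \<phi> x) * ext_pperm \<beta> \<theta> \<phi> X M + d (ext_pperm \<beta> \<theta> \<phi> X M)"
proof -
  let ?T = "pperm_term \<beta> \<theta> \<phi> X M" and ?T' = "pperm_term \<beta> \<theta> \<phi> (insert x X) M"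
  have "?T' (\<psi>(x \<mapsto> x)) + ?T' \<psi> + (\<Sum>y\<in>dom \<psi>. ?T' (\<psi>(y \<mapsto> x, x \<mapsto> the (\<psi> y))))
      + (\<Sum>z\<in>X - ran \<psi>. ?T' (\<psi>(x \<mapsto> z))) + (\<Sum>y\<in>X - dom \<psi>. ?T' (\<psi>(y \<mapsto> x)))
    = (\<beta> * M x x + \<theta> x * \<phi> x) * ?T \<psi> + d (?T \<psi>)"
    if \<psi>: "\<psi> \<in> partial_perms X" for \<psi>
  proof -
    note new = new_vertex[OF fin x \<psi>]
    let ?c = "\<beta> ^ pperm_cycles \<psi>"
    let ?P = "\<lambda>D. \<Prod>a\<in>D. M a (the (\<psi> a))"
    let ?Q = "\<lambda>D. \<Prod>a\<in>D. \<theta> a" and ?R = "\<lambda>D. \<Prod>a\<in>D. \<phi> a"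
    let ?D = "dom \<psi>" and ?S = "X - ran \<psi>" and ?E = "X - dom \<psi>"
    have finD: "finite ?D" using partial_permD(1)[OF \<psi>] fin by (rule finite_subset)
    have finS: "finite ?S" and finE: "finite ?E" using fin by auto
    have xD: "x \<notin> ?D" and xS: "x \<notin> ?S" and xE: "x \<notin> ?E" using new x by auto
    have upd: "(\<Prod>a\<in>D. M a (the ((\<psi>(x \<mapsto> z)) a))) = ?P D" if "D \<subseteq> ?D" for D z
      by (rule prod.cong) (use that xD in auto)
    have insX: "insert x X - ran \<psi> = insert x ?S" "insert x X - dom \<psi> = insert x ?E"
      using new x by auto
    have loop: "?T' (\<psi>(x \<mapsto> x)) = \<beta> * M x x * ?T \<psi>"
    proof -
      have "ran (\<psi>(x \<mapsto> x)) = insert x (ran \<psi>)" using new(1) by (rule ran_map_upd)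
      then have "insert x X - ran (\<psi>(x \<mapsto> x)) = ?S" "insert x X - dom (\<psi>(x \<mapsto> x)) = ?E"
        using x new by auto
      moreover have "(\<Prod>a\<in>dom (\<psi>(x \<mapsto> x)). M a (the ((\<psi>(x \<mapsto> x)) a))) = M x x * ?P ?D"
        using upd[of ?D x] finD xD by simp
      ultimately show ?thesis
        unfolding pperm_term_def cycles_add_loop[OF fin x \<psi>] by (simp add: ac_simps)
    qed
    have iso: "?T' \<psi> = \<theta> x * \<phi> x * ?T \<psi>"
      unfolding pperm_term_def insX using finS finE xS xE by (simp add: ac_simps)
    have arc: "?T' (\<psi>(y \<mapsto> x, x \<mapsto> the (\<psi> y)))
        = ?c * (d (M y (the (\<psi> y))) * ?P (?D - {y})) * ?Q ?S * ?R ?E" if "y \<in> ?D" for y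
    proof -
      obtain z where z: "\<psi> y = Some z" using \<open>y \<in> ?D\<close> by auto
      let ?\<psi>' = "\<psi>(y \<mapsto> x, x \<mapsto> z)"
      have yx: "y \<noteq> x" and yX: "y \<in> X" and zX: "z \<in> X"
        using z new(1) partial_permD(6,7)[OF \<psi> z] by auto
      have dom: "dom ?\<psi>' = insert x (insert y (?D - {y}))"
        using \<open>y \<in> ?D\<close> by auto
      have "ran ?\<psi>' = insert x (ran \<psi>)"
      proof (intro equalityI subsetI)
        fix b assume "b \<in> ran ?\<psi>'"
        then show "b \<in> insert x (ran \<psi>)"
          using z yx by (auto simp: ran_def split: if_splits)
      next
        fix b assume "b \<in> insert x (ran \<psi>)"
        then consider "b = x" | a where "\<psi> a = Some b" by (auto simp: ran_def)
        then show "b \<in> ran ?\<psi>'"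
        proof cases
          case 1
          then have "?\<psi>' y = Some b" using yx by simp
          then show ?thesis by (rule ranI)
        next
          case 2
          then have "?\<psi>' (if a = y then x else a) = Some b" using z new(1) by auto
          then show ?thesis by (rule ranI)
        qed
      qed
      then have ran: "insert x X - ran ?\<psi>' = ?S" using x by auto
      have dom': "insert x X - dom ?\<psi>' = ?E" using \<open>y \<in> ?D\<close> x by auto
      have "(\<Prod>a\<in>?D - {y}. M a (the (?\<psi>' a))) = ?P (?D - {y})"
        by (rule prod.cong) (use xD in auto)
      then have "(\<Prod>a\<in>dom ?\<psi>'. M a (the (?\<psi>' a))) = M x z * (M y x * ?P (?D - {y}))"
        unfolding dom using finD xD yx by (simp del: insert_Diff_single)
      then show ?thesis
        using cycles_subdivide_arc[OF fin x \<psi> z] dM[OF yX zX]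
        unfolding z option.sel pperm_term_def ran dom' by (simp add: ac_simps)
    qed
    have start: "?T' (\<psi>(x \<mapsto> z)) = ?c * ?P ?D * (d (\<theta> z) * ?Q (?S - {z})) * ?R ?E" if z: "z \<in> ?S" for z
    proof -
      have "ran (\<psi>(x \<mapsto> z)) = insert z (ran \<psi>)" using new(1) by (rule ran_map_upd)
      then have ran: "insert x X - ran (\<psi>(x \<mapsto> z)) = insert x (?S - {z})"
        and dom': "insert x X - dom (\<psi>(x \<mapsto> z)) = ?E"
        using x new z by auto
      have "(\<Prod>a\<in>dom (\<psi>(x \<mapsto> z)). M a (the ((\<psi>(x \<mapsto> z)) a))) = M x z * ?P ?D"
        using upd[of ?D z] finD xD by simp
      moreover have "?Q (insert x (?S - {z})) = \<theta> x * ?Q (?S - {z})"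
        using finS xS by simp
      moreover have "d (\<theta> z) = \<theta> x * M x z" using z by (intro d\<theta>) simp
      ultimately show ?thesis
        unfolding pperm_term_def cycles_append_start[OF fin x \<psi> z] ran dom' by (simp add: ac_simps)
    qed
    have stop: "?T' (\<psi>(y \<mapsto> x)) = ?c * ?P ?D * ?Q ?S * (d (\<phi> y) * ?R (?E - {y}))" if y: "y \<in> ?E" for y
    proof -
      have yN: "\<psi> y = None" using y by auto
      then have "ran (\<psi>(y \<mapsto> x)) = insert x (ran \<psi>)" by (rule ran_map_upd)
      then have ran: "insert x X - ran (\<psi>(y \<mapsto> x)) = ?S"
        and dom': "insert x X - dom (\<psi>(y \<mapsto> x)) = insert x (?E - {y})"
        using x new y by auto
      have "(\<Prod>a\<in>?D. M a (the ((\<psi>(y \<mapsto> x)) a))) = ?P ?D"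
        by (rule prod.cong) (use y in auto)
      then have "(\<Prod>a\<in>dom (\<psi>(y \<mapsto> x)). M a (the ((\<psi>(y \<mapsto> x)) a))) = M y x * ?P ?D"
        using finD y by simp
      moreover have "?R (insert x (?E - {y})) = \<phi> x * ?R (?E - {y})"
        using finE xE by simp
      moreover have "d (\<phi> y) = M y x * \<phi> x" using y by (intro d\<phi>) simp
      ultimately show ?thesis
        unfolding pperm_term_def cycles_append_end[OF fin x \<psi> y] ran dom' by (simp add: ac_simps)
    qed
    have "d (?T \<psi>) = ?c * d (?P ?D) * ?Q ?S * ?R ?E + ?c * ?P ?D * d (?Q ?S) * ?R ?E
        + ?c * ?P ?D * ?Q ?S * d (?R ?E)"
      unfolding pperm_term_def by (simp add: mult power_zero[OF d\<beta>] algebra_simps)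
    also have "\<dots> = (\<Sum>y\<in>?D. ?c * (d (M y (the (\<psi> y))) * ?P (?D - {y})) * ?Q ?S * ?R ?E)
        + (\<Sum>z\<in>?S. ?c * ?P ?D * (d (\<theta> z) * ?Q (?S - {z})) * ?R ?E)
        + (\<Sum>y\<in>?E. ?c * ?P ?D * ?Q ?S * (d (\<phi> y) * ?R (?E - {y})))"
      unfolding prod[OF finD] prod[OF finS] prod[OF finE] sum_distrib_left sum_distrib_right ..
    also have "\<dots> = (\<Sum>y\<in>?D. ?T' (\<psi>(y \<mapsto> x, x \<mapsto> the (\<psi> y))))
        + (\<Sum>z\<in>?S. ?T' (\<psi>(x \<mapsto> z))) + (\<Sum>y\<in>?E. ?T' (\<psi>(y \<mapsto> x)))"
      using arc start stop by (intro arg_cong2[of _ _ _ _ "(+)"] sum.cong refl) (auto simp del: fun_upd_apply)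
    finally show ?thesis
      unfolding loop iso by (simp add: algebra_simps)
  qed
  then show ?thesis
    unfolding ext_pperm_eq_sum_terms sum_partial_perms_insert[OF fin x]
    by (simp add: sum.distrib sum_distrib_left sum)
qed

section \<open>Formal sums of power series\<close>

lemma coeff_zero [simp]: "mfps_coeff 0 m = 0"
  by (simp add: zero_mfps.rep_eq)
lemma coeff_one: "mfps_coeff 1 m = (if m = 0 then 1 else 0)"
  by (simp add: one_mfps.rep_eq)
lemma coeff_add [simp]: "mfps_coeff (f + g) m = mfps_coeff f m + mfps_coeff g m"
  by (simp add: plus_mfps.rep_eq)
lemma coeff_diff [simp]: "mfps_coeff (f - g) m = mfps_coeff f m - mfps_coeff g m"
  by (simp add: minus_mfps.rep_eq)
lemma coeff_mult:
  "mfps_coeff (f * g) m = (\<Sum>(a, b)\<in>{(a, b). a + b = m}. mfps_coeff f a * mfps_coeff g b)"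
  by (simp add: times_mfps.rep_eq)
lemma coeff_const: "mfps_coeff (mfps_const c) m = (if m = 0 then c else 0)"
  by (simp add: mfps_const.rep_eq)
lemma coeff_var: "mfps_coeff (mfps_var v) m = (if m = Poly_Mapping.single v 1 then 1 else 0)"
  by (simp add: mfps_var.rep_eq)
lemma coeff_sum [simp]: "mfps_coeff (\<Sum>i\<in>I. f i) m = (\<Sum>i\<in>I. mfps_coeff (f i) m)"
  by (induction I rule: infinite_finite_induct) simp_all

lemma coeff_mult_nonzero:
  assumes "mfps_coeff (f * g) m \<noteq> 0"
  obtains a b where "a + b = m" "mfps_coeff f a \<noteq> 0" "mfps_coeff g b \<noteq> 0"
proof -
  obtain p where "p \<in> {(a, b). a + b = m}" "(case p of (a, b) \<Rightarrow> mfps_coeff f a * mfps_coeff g b) \<noteq> 0"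
    using assms unfolding coeff_mult by (rule sum.not_neutral_contains_not_neutral)
  then show ?thesis
    using that by (cases p) (metis (mono_tags, lifting) case_prod_conv mem_Collect_eq mult_zero_left mult_zero_right)
qed

lemma coeff_const_mult [simp]:
  fixes f :: "('v, 'a::comm_ring_1) mfps"
  shows "mfps_coeff (mfps_const c * f) m = c * mfps_coeff f m"
proof -
  have "mfps_coeff (mfps_const c * f) m
      = (\<Sum>(a, b)\<in>{(0 :: 'v \<Rightarrow>\<^sub>0 nat, m)}. mfps_coeff (mfps_const c) a * mfps_coeff f b)"
    unfolding coeff_mult
    by (rule sum.mono_neutral_right) (auto simp: finite_mfps_splittings coeff_const split: if_splits)
  then show ?thesis by (simp add: coeff_const)
qed

lemma mfps_const_mult: "mfps_const (a * b) = mfps_const a * (mfps_const b :: ('v, 'a::comm_ring_1) mfps)"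
  by (rule mfps_eqI) (simp add: coeff_const)

lemma const_one [simp]: "mfps_const 1 = (1 :: ('v, 'a::comm_ring_1) mfps)"
  by (rule mfps_eqI) (simp add: coeff_const coeff_one)

lemma of_nat_eq_const: "of_nat k = (mfps_const (of_nat k) :: ('v, 'a::comm_ring_1) mfps)"
proof (rule mfps_eqI)
  fix m show "mfps_coeff (of_nat k :: ('v, 'a) mfps) m = mfps_coeff (mfps_const (of_nat k)) m"
    by (induction k) (simp_all add: coeff_const coeff_one)
qed

text \<open>For a sequence, formal summability means that the partial sums are eventually constant at each
  monomial.\<close>

lemma has_sum_iff:
  fixes f :: "nat \<Rightarrow> ('v, 'a::comm_ring_1) mfps"
  shows "mfps_has_sum f s \<longleftrightarrow>
     (\<forall>m. \<exists>N. (\<forall>k\<ge>N. mfps_coeff (f k) m = 0) \<and> mfps_coeff s m = (\<Sum>k<N. mfps_coeff (f k) m))"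
proof (intro iffI allI)
  fix m assume "mfps_has_sum f s"
  then have fin: "finite {k. mfps_coeff (f k) m \<noteq> 0}"
    and s: "mfps_coeff s m = (\<Sum>k | mfps_coeff (f k) m \<noteq> 0. mfps_coeff (f k) m)"
    by (auto simp: mfps_has_sum_def)
  obtain N where N: "{k. mfps_coeff (f k) m \<noteq> 0} \<subseteq> {..<N}"
    using finite_nat_iff_bounded[THEN iffD1, OF fin] by blast
  then have "mfps_coeff s m = (\<Sum>k<N. mfps_coeff (f k) m)"
    unfolding s by (intro sum.mono_neutral_left) auto
  moreover have "\<forall>k\<ge>N. mfps_coeff (f k) m = 0"
    using N by (meson lessThan_iff mem_Collect_eq not_less subsetD)
  ultimately show "\<exists>N. (\<forall>k\<ge>N. mfps_coeff (f k) m = 0) \<and> mfps_coeff s m = (\<Sum>k<N. mfps_coeff (f k) m)"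
    by blast
next
  assume *: "\<forall>m. \<exists>N. (\<forall>k\<ge>N. mfps_coeff (f k) m = 0) \<and> mfps_coeff s m = (\<Sum>k<N. mfps_coeff (f k) m)"
  show "mfps_has_sum f s"
    unfolding mfps_has_sum_def
  proof
    fix m
    obtain N where N: "\<forall>k\<ge>N. mfps_coeff (f k) m = 0" "mfps_coeff s m = (\<Sum>k<N. mfps_coeff (f k) m)"
      using * by blast
    then have sub: "{k. mfps_coeff (f k) m \<noteq> 0} \<subseteq> {..<N}"
      by (auto simp: not_less[symmetric])
    then have "finite {k. mfps_coeff (f k) m \<noteq> 0}"
      by (rule finite_subset) simp
    moreover have "mfps_coeff s m = (\<Sum>k | mfps_coeff (f k) m \<noteq> 0. mfps_coeff (f k) m)"
      unfolding N(2) using sub by (intro sum.mono_neutral_right) auto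
    ultimately show "finite {k. mfps_coeff (f k) m \<noteq> 0} \<and>
        mfps_coeff s m = (\<Sum>k | mfps_coeff (f k) m \<noteq> 0. mfps_coeff (f k) m)" ..
  qed
qed

lemma has_sum_unique: "mfps_has_sum f s \<Longrightarrow> mfps_has_sum f t \<Longrightarrow> s = t"
  by (rule mfps_eqI) (simp add: mfps_has_sum_def)

lemma has_sum_Suc:
  assumes "mfps_has_sum (\<lambda>k. f (Suc k)) s"
  shows "mfps_has_sum f (f 0 + s)"
  unfolding has_sum_iff
proof
  fix m
  obtain N where N: "\<forall>k\<ge>N. mfps_coeff (f (Suc k)) m = 0" "mfps_coeff s m = (\<Sum>k<N. mfps_coeff (f (Suc k)) m)"
    using assms unfolding has_sum_iff by blast
  have "mfps_coeff (f k) m = 0" if "k \<ge> Suc N" for k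
    using N(1) that by (cases k) auto
  then show "\<exists>N. (\<forall>k\<ge>N. mfps_coeff (f k) m = 0) \<and> mfps_coeff (f 0 + s) m = (\<Sum>k<N. mfps_coeff (f k) m)"
    using N(2) by (intro exI[of _ "Suc N"]) (simp add: sum.lessThan_Suc_shift del: sum.lessThan_Suc)
qed

lemma has_sum_telescope:
  assumes "\<And>m. \<exists>N. \<forall>k\<ge>N. mfps_coeff (g k) m = 0"
  shows "mfps_has_sum (\<lambda>k. g k - g (Suc k)) (g 0)"
  unfolding has_sum_iff
proof
  fix m
  obtain N where N: "\<forall>k\<ge>N. mfps_coeff (g k) m = 0"
    using assms by blast
  have "(\<Sum>k<N. mfps_coeff (g k) m - mfps_coeff (g (Suc k)) m) = mfps_coeff (g 0) m - mfps_coeff (g N) m"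
    by (induction N) simp_all
  with N show "\<exists>N. (\<forall>k\<ge>N. mfps_coeff (g k - g (Suc k)) m = 0) \<and>
      mfps_coeff (g 0) m = (\<Sum>k<N. mfps_coeff (g k - g (Suc k)) m)"
    by (intro exI[of _ N]) simp
qed

text \<open>Continuity for the product topology with discrete coefficients: each output coefficient is
  determined by finitely many input coefficients (stated at zero, for use with additive maps).
  This is what allows an operator to be applied to a formal sum term by term.\<close>

definition local_op :: "(('v, 'a::comm_ring_1) mfps \<Rightarrow> ('v, 'a) mfps) \<Rightarrow> bool" where
  "local_op d \<longleftrightarrow> (\<forall>m. \<exists>S. finite S \<and> (\<forall>f. (\<forall>m'\<in>S. mfps_coeff f m' = 0) \<longrightarrow> mfps_coeff (d f) m = 0))"

lemma local_opI:
  assumes "\<And>m. finite (S m)"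
    and "\<And>f m. (\<And>m'. m' \<in> S m \<Longrightarrow> mfps_coeff f m' = 0) \<Longrightarrow> mfps_coeff (d f) m = 0"
  shows "local_op d"
  unfolding local_op_def using assms by metis

lemma local_op_mult:
  fixes c :: "('v, 'a::comm_ring_1) mfps"
  shows "local_op (\<lambda>f. c * f)"
proof (rule local_opI)
  fix m :: "'v \<Rightarrow>\<^sub>0 nat"
  show "finite (snd ` {(a, b). a + b = m})"
    using finite_mfps_splittings by (rule finite_imageI)
  fix f :: "('v, 'a) mfps"
  assume "\<And>m'. m' \<in> snd ` {(a, b). a + b = m} \<Longrightarrow> mfps_coeff f m' = 0"
  then show "mfps_coeff (c * f) m = 0"
    unfolding coeff_mult by (intro sum.neutral) force
qed

lemma local_op_add:
  assumes "local_op d" "local_op d'"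
  shows "local_op (\<lambda>f. d f + d' f)"
  unfolding local_op_def
proof
  fix m
  obtain S S' where "finite S" "\<forall>f. (\<forall>m'\<in>S. mfps_coeff f m' = 0) \<longrightarrow> mfps_coeff (d f) m = 0"
    "finite S'" "\<forall>f. (\<forall>m'\<in>S'. mfps_coeff f m' = 0) \<longrightarrow> mfps_coeff (d' f) m = 0"
    using assms unfolding local_op_def by metis
  then show "\<exists>S. finite S \<and> (\<forall>f. (\<forall>m'\<in>S. mfps_coeff f m' = 0) \<longrightarrow> mfps_coeff (d f + d' f) m = 0)"
    by (intro exI[of _ "S \<union> S'"]) auto
qed

lemma local_op_zero: "local_op (\<lambda>f. 0)"
  by (rule local_opI[of "\<lambda>_. {}"]) simp_all

lemma local_op_comp:
  assumes "local_op d" "local_op d'"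
  shows "local_op (\<lambda>f. d (d' f))"
  unfolding local_op_def
proof
  fix m
  obtain S where S: "finite S" "\<forall>f. (\<forall>m'\<in>S. mfps_coeff f m' = 0) \<longrightarrow> mfps_coeff (d f) m = 0"
    using assms(1) unfolding local_op_def by metis
  obtain S' where S': "\<And>m. finite (S' m)"
    "\<And>m. \<forall>f. (\<forall>m'\<in>S' m. mfps_coeff f m' = 0) \<longrightarrow> mfps_coeff (d' f) m = 0"
    using assms(2) unfolding local_op_def by metis
  show "\<exists>S. finite S \<and> (\<forall>f. (\<forall>m'\<in>S. mfps_coeff f m' = 0) \<longrightarrow> mfps_coeff (d (d' f)) m = 0)"
    using S S' by (intro exI[of _ "\<Union>(S' ` S)"]) simp
qed

text \<open>Subtract a partial sum of \<open>s\<close> so long that the difference vanishes at all the finitely many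
  monomials that influence the coefficient of \<open>d s\<close> at \<open>m\<close>.\<close>

lemma has_sum_local_op:
  assumes d: "local_op d" "\<And>f g. d (f + g) = d f + d g" and s: "mfps_has_sum f s"
  shows "mfps_has_sum (\<lambda>k::nat. d (f k)) (d s)"
  unfolding has_sum_iff
proof
  fix m
  obtain S where S: "finite S" "\<And>f. (\<forall>m'\<in>S. mfps_coeff f m' = 0) \<Longrightarrow> mfps_coeff (d f) m = 0"
    using d(1) unfolding local_op_def by metis
  have d0: "d 0 = 0" using d(2)[of 0 0] by simp
  have fin: "finite {k. mfps_coeff (f k) m' \<noteq> 0}" for m'
    using s unfolding mfps_has_sum_def by blast
  have "finite (\<Union>m\<in>S. {k. mfps_coeff (f k) m \<noteq> 0})"
    using S(1) fin by (rule finite_UN_I)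
  then obtain N where N: "(\<Union>m\<in>S. {k. mfps_coeff (f k) m \<noteq> 0}) \<subseteq> {..<N}"
    using finite_nat_iff_bounded by blast
  have z: "mfps_coeff (f k) m' = 0" if "k \<ge> N" "m' \<in> S" for k m'
  proof (rule ccontr)
    assume "mfps_coeff (f k) m' \<noteq> 0"
    then have "k \<in> {..<N}" using that(2) by (intro subsetD[OF N]) blast
    with that(1) show False by simp
  qed
  have "mfps_coeff (s - (\<Sum>k<N. f k)) m' = 0" if "m' \<in> S" for m'
  proof -
    have "mfps_coeff s m' = (\<Sum>k | mfps_coeff (f k) m' \<noteq> 0. mfps_coeff (f k) m')"
      using s unfolding mfps_has_sum_def by blast
    also have "\<dots> = (\<Sum>k<N. mfps_coeff (f k) m')"
      using N that by (intro sum.mono_neutral_left) auto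
    finally show ?thesis by simp
  qed
  then have "mfps_coeff (d (s - (\<Sum>k<N. f k))) m = 0"
    by (intro S(2)) simp
  moreover have "d (\<Sum>k<N. f k) = (\<Sum>k<N. d (f k))"
    by (induction N) (simp_all add: d0 d(2))
  then have "d s = d (s - (\<Sum>k<N. f k)) + (\<Sum>k<N. d (f k))"
    using d(2)[of "s - (\<Sum>k<N. f k)" "\<Sum>k<N. f k"] by simp
  ultimately have "mfps_coeff (d s) m = (\<Sum>k<N. mfps_coeff (d (f k)) m)"
    by simp
  moreover have "\<forall>k\<ge>N. mfps_coeff (d (f k)) m = 0"
    using z by (intro allI impI S(2)) simp
  ultimately show "\<exists>N. (\<forall>k\<ge>N. mfps_coeff (d (f k)) m = 0) \<and>
      mfps_coeff (d s) m = (\<Sum>k<N. mfps_coeff (d (f k)) m)" by blast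
qed

lemma has_sum_mult: "mfps_has_sum f s \<Longrightarrow> mfps_has_sum (\<lambda>k::nat. c * f k) (c * s)"
  by (rule has_sum_local_op[OF local_op_mult]) (simp_all add: distrib_left)

lemma has_sum_add:
  assumes "mfps_has_sum f s" "mfps_has_sum g t"
  shows "mfps_has_sum (\<lambda>k::nat. f k + g k) (s + t)"
  unfolding has_sum_iff
proof
  fix m
  obtain N where N: "\<forall>k\<ge>N. mfps_coeff (f k) m = 0" "mfps_coeff s m = (\<Sum>k<N. mfps_coeff (f k) m)"
    using assms(1) unfolding has_sum_iff by blast
  obtain N' where N': "\<forall>k\<ge>N'. mfps_coeff (g k) m = 0" "mfps_coeff t m = (\<Sum>k<N'. mfps_coeff (g k) m)"
    using assms(2) unfolding has_sum_iff by blast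
  have "(\<Sum>k<N. mfps_coeff (f k) m) = (\<Sum>k<max N N'. mfps_coeff (f k) m)"
    by (rule sum.mono_neutral_left) (use N(1) in auto)
  moreover have "(\<Sum>k<N'. mfps_coeff (g k) m) = (\<Sum>k<max N N'. mfps_coeff (g k) m)"
    by (rule sum.mono_neutral_left) (use N'(1) in auto)
  ultimately show "\<exists>N. (\<forall>k\<ge>N. mfps_coeff (f k + g k) m = 0) \<and>
      mfps_coeff (s + t) m = (\<Sum>k<N. mfps_coeff (f k + g k) m)"
    using N N' by (intro exI[of _ "max N N'"]) (simp add: sum.distrib)
qed

lemma has_sum_zero: "mfps_has_sum (\<lambda>k::nat. 0) 0"
  by (simp add: mfps_has_sum_def)

lemma has_sum_sum:
  "(\<And>i. i \<in> I \<Longrightarrow> mfps_has_sum (f i) (s i)) \<Longrightarrow>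
    mfps_has_sum (\<lambda>k::nat. \<Sum>i\<in>I. f i k) (\<Sum>i\<in>I. s i)"
  by (induction I rule: infinite_finite_induct) (simp_all add: has_sum_zero has_sum_add)

section \<open>Derivations and gradings of power series\<close>

text \<open>A derivation that is linear over the constants and commutes with formal sums.\<close>

locale local_derivation = derivation d
  for d :: "('v, 'a::comm_ring_1) mfps \<Rightarrow> ('v, 'a) mfps" +
  assumes local: "local_op d" and const: "d (mfps_const c) = 0"
begin

lemma const_mult: "d (mfps_const c * f) = mfps_const c * d f"
  by (simp add: mult const)

lemma has_sum: "mfps_has_sum f s \<Longrightarrow> mfps_has_sum (\<lambda>k::nat. d (f k)) (d s)"
  using local add by (rule has_sum_local_op)

end

lemma local_derivation_add:
  assumes "local_derivation d" "local_derivation d'"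
  shows "local_derivation (\<lambda>f. d f + d' f)"
proof -
  interpret d: local_derivation d by fact
  interpret d': local_derivation d' by fact
  show ?thesis
    by unfold_locales
      (simp_all add: d.add d'.add d.mult d'.mult d.const d'.const local_op_add d.local d'.local algebra_simps)
qed

lemma local_derivation_scale:
  assumes "local_derivation d"
  shows "local_derivation (\<lambda>f. c * d f)"
proof -
  interpret d: local_derivation d by fact
  show ?thesis
    by unfold_locales
      (simp_all add: d.add d.mult d.const local_op_comp[OF local_op_mult d.local] algebra_simps)
qed

lemma local_derivation_zero: "local_derivation (\<lambda>f. 0)"
  by unfold_locales (simp_all add: local_op_zero)

lemma local_derivation_sum:
  "(\<And>i. i \<in> I \<Longrightarrow> local_derivation (d i)) \<Longrightarrow> local_derivation (\<lambda>f. \<Sum>i\<in>I. d i f)"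
  by (induction I rule: infinite_finite_induct)
    (simp_all add: local_derivation_zero local_derivation_add)

text \<open>For an additive weight \<open>w\<close> of monomials this is the Euler operator of the corresponding
  grading.\<close>

definition mfps_euler :: "(('v \<Rightarrow>\<^sub>0 nat) \<Rightarrow> nat) \<Rightarrow> ('v, 'a::comm_ring_1) mfps \<Rightarrow> ('v, 'a) mfps"
  where "mfps_euler w f = Abs_mfps (\<lambda>m. of_nat (w m) * mfps_coeff f m)"

definition mfps_deriv :: "'v \<Rightarrow> ('v, 'a::comm_ring_1) mfps \<Rightarrow> ('v, 'a) mfps"
  where "mfps_deriv v f = Abs_mfps (\<lambda>m.
    of_nat (Suc (Poly_Mapping.lookup m v)) * mfps_coeff f (m + Poly_Mapping.single v 1))"

text \<open>The derivation that maps each indeterminate \<open>v\<close> to the prescribed series \<open>w v\<close>.\<close>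

definition vector_field :: "('v::finite \<Rightarrow> ('v, 'a::comm_ring_1) mfps) \<Rightarrow> ('v, 'a) mfps \<Rightarrow> ('v, 'a) mfps" where
  "vector_field w f = (\<Sum>v\<in>UNIV. w v * mfps_deriv v f)"

lemma coeff_euler [simp]: "mfps_coeff (mfps_euler w f) m = of_nat (w m) * mfps_coeff f m"
  by (simp add: mfps_euler_def Abs_mfps_inverse)

lemma coeff_deriv:
  "mfps_coeff (mfps_deriv v f) m =
    of_nat (Suc (Poly_Mapping.lookup m v)) * mfps_coeff f (m + Poly_Mapping.single v 1)"
  by (simp add: mfps_deriv_def Abs_mfps_inverse)

locale weight =
  fixes w :: "('v \<Rightarrow>\<^sub>0 nat) \<Rightarrow> nat"
  assumes w_add: "w (a + b) = w a + w b"
begin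

lemma w_zero [simp]: "w 0 = 0"
  using w_add[of 0 0] by simp

lemma euler_mult: "mfps_euler w (f * g) = mfps_euler w f * g + f * mfps_euler w g"
proof (rule mfps_eqI)
  fix m
  have "mfps_coeff (mfps_euler w (f * g)) m =
      (\<Sum>(a, b)\<in>{(a, b). a + b = m}. of_nat (w m) * (mfps_coeff f a * mfps_coeff g b))"
    by (simp add: coeff_mult sum_distrib_left case_prod_unfold)
  also have "\<dots> = (\<Sum>(a, b)\<in>{(a, b). a + b = m}.
      of_nat (w a) * mfps_coeff f a * mfps_coeff g b + mfps_coeff f a * (of_nat (w b) * mfps_coeff g b))"
    by (rule sum.cong) (auto simp: w_add algebra_simps)
  finally show "mfps_coeff (mfps_euler w (f * g)) m = mfps_coeff (mfps_euler w f * g + f * mfps_euler w g) m"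
    by (simp add: coeff_mult sum.distrib case_prod_unfold)
qed

lemma euler_local_derivation: "local_derivation (mfps_euler w)"
proof
  show "local_op (mfps_euler w)"
    by (rule local_opI[of "\<lambda>m. {m}"]) simp_all
  show "mfps_euler w (mfps_const c) = 0" for c
    by (rule mfps_eqI) (simp add: coeff_const)
  show "mfps_euler w (f + g) = mfps_euler w f + mfps_euler w g" for f g
    by (rule mfps_eqI) (simp add: distrib_left)
qed (rule euler_mult)

text \<open>The order of vanishing with respect to the weight; it controls the convergence of power
  series in a series or in a matrix of series.\<close>

definition vanishes_below :: "nat \<Rightarrow> ('v, 'a::comm_ring_1) mfps \<Rightarrow> bool" where
  "vanishes_below k f \<longleftrightarrow> (\<forall>m. w m < k \<longrightarrow> mfps_coeff f m = 0)"

lemma vanishes_below_mult: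
  assumes "vanishes_below j f" "vanishes_below k g"
  shows "vanishes_below (j + k) (f * g)"
  unfolding vanishes_below_def
proof (intro allI impI, rule ccontr)
  fix m assume m: "w m < j + k" and "mfps_coeff (f * g) m \<noteq> 0"
  then obtain a b where "a + b = m" "mfps_coeff f a \<noteq> 0" "mfps_coeff g b \<noteq> 0"
    by (elim coeff_mult_nonzero)
  then have "j \<le> w a" "k \<le> w b"
    using assms unfolding vanishes_below_def by (meson not_less)+
  then show False using m w_add[of a b] \<open>a + b = m\<close> by simp
qed

lemma vanishes_below_0 [simp]: "vanishes_below 0 f"
  by (simp add: vanishes_below_def)

lemma vanishes_below_sum: "(\<And>i. i \<in> I \<Longrightarrow> vanishes_below k (f i)) \<Longrightarrow> vanishes_below k (\<Sum>i\<in>I. f i)"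
  by (simp add: vanishes_below_def)

lemma vanishes_below_1_mult:
  assumes "vanishes_below 1 f"
  shows "vanishes_below 1 (g * f)"
  using vanishes_below_mult[OF vanishes_below_0[of g] assms] by simp

lemma vanishes_below_power: "vanishes_below 1 f \<Longrightarrow> vanishes_below k (f ^ k)"
  using vanishes_below_mult[of 1 f] by (induction k) simp_all

lemma has_sum_vanishing:
  assumes "\<And>k. vanishes_below k (f k)"
  shows "mfps_has_sum f (mfps_sum f)"
proof (rule mfps_has_sum_mfps_sum)
  fix m
  have "k \<le> w m" if "mfps_coeff (f k) m \<noteq> 0" for k
    using assms[of k] that unfolding vanishes_below_def by (meson not_less)
  then have "{k. mfps_coeff (f k) m \<noteq> 0} \<subseteq> {..w m}" by auto
  then show "finite {k. mfps_coeff (f k) m \<noteq> 0}" by (rule finite_subset) simp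
qed

lemma vanishes_below_mfps_sum:
  assumes "mfps_has_sum f s" "\<And>i. vanishes_below k (f i)"
  shows "vanishes_below k s"
  using assms unfolding mfps_has_sum_def vanishes_below_def by simp

lemma exp_has_sum:
  fixes f :: "('v, 'a::field_char_0) mfps"
  assumes "vanishes_below 1 f"
  shows "mfps_has_sum (\<lambda>k. mfps_const (1 / fact k) * f ^ k) (mfps_exp f)"
  unfolding mfps_exp_def
  by (rule has_sum_vanishing)
    (use vanishes_below_mult[OF vanishes_below_0 vanishes_below_power[OF assms]] in simp)

text \<open>Term by term, \<open>d (f\<^sup>k\<^sup>+\<^sup>1 / (k + 1)!) = (f\<^sup>k / k!) * d f\<close>.\<close>

lemma derivation_exp:
  fixes f :: "('v, 'a::field_char_0) mfps"
  assumes "local_derivation d" "vanishes_below 1 f"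
  shows "d (mfps_exp f) = d f * mfps_exp f"
proof -
  interpret local_derivation d by fact
  let ?F = "\<lambda>k. mfps_const (1 / fact k) * f ^ k"
  have "mfps_has_sum (\<lambda>k. d f * ?F k) (d f * mfps_exp f)"
    by (rule has_sum_mult[OF exp_has_sum[OF assms(2)]])
  moreover have "d (?F (Suc k)) = d f * ?F k" for k
  proof -
    have "(mfps_const (1 / fact k) :: ('v, 'a) mfps) = mfps_const (1 / fact (Suc k)) * of_nat (Suc k)"
      unfolding of_nat_eq_const mfps_const_mult[symmetric]
      by (simp add: fact_Suc del: of_nat_Suc)
    then show ?thesis
      by (simp only: const_mult power) (simp add: ac_simps)
  qed
  ultimately have "mfps_has_sum (\<lambda>k. d (?F (Suc k))) (d f * mfps_exp f)"
    by simp
  then have "mfps_has_sum (\<lambda>k. d (?F k)) (d (?F 0) + d f * mfps_exp f)"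
    by (rule has_sum_Suc)
  moreover have "d (?F 0) = 0" by (simp add: one)
  ultimately show ?thesis
    using has_sum_unique[OF has_sum[OF exp_has_sum[OF assms(2)]]] by simp
qed

text \<open>Only the summand \<open>1\<close> of the exponential series contributes in weight zero.\<close>

lemma coeff_exp_weight_zero:
  fixes f :: "('v, 'a::field_char_0) mfps"
  assumes "vanishes_below 1 f" "w m = 0"
  shows "mfps_coeff (mfps_exp f) m = mfps_coeff 1 m"
proof -
  let ?F = "\<lambda>k. mfps_const (1 / fact k) * f ^ k"
  have z: "mfps_coeff (?F k) m = 0" if "k \<noteq> 0" for k
    using vanishes_below_power[OF assms(1), of k] assms(2) that
    by (simp add: vanishes_below_def)
  have "mfps_coeff (mfps_exp f) m = (\<Sum>k | mfps_coeff (?F k) m \<noteq> 0. mfps_coeff (?F k) m)"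
    using exp_has_sum[OF assms(1)] unfolding mfps_has_sum_def by blast
  also have "\<dots> = (\<Sum>k\<in>{0}. mfps_coeff (?F k) m)"
    using z by (intro sum.mono_neutral_left) auto
  finally show ?thesis by simp
qed

end

lemma deriv_eq_euler:
  "mfps_coeff (mfps_deriv v f) m =
    mfps_coeff (mfps_euler (\<lambda>m. Poly_Mapping.lookup m v) f) (m + Poly_Mapping.single v 1)"
  by (simp add: coeff_deriv lookup_add)

text \<open>The splittings of \<open>m\<close> times the indeterminate \<open>v\<close> whose first part is divisible by
  \<open>v\<close> correspond to the splittings of \<open>m\<close>, and the hypothesis discards the other ones.\<close>

lemma coeff_mult_shift:
  assumes "\<And>a. Poly_Mapping.lookup a v = 0 \<Longrightarrow> mfps_coeff F a = 0"
  shows "mfps_coeff (F * g) (m + Poly_Mapping.single v 1) =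
    (\<Sum>(a, b)\<in>{(a, b). a + b = m}. mfps_coeff F (a + Poly_Mapping.single v 1) * mfps_coeff g b)"
proof -
  let ?s = "Poly_Mapping.single v (1::nat)"
  have cancel: "a - ?s + ?s = a" if "Poly_Mapping.lookup a v \<noteq> 0" for a
    using that by (intro poly_mapping_eqI) (auto simp: lookup_add lookup_minus lookup_single when_def)
  have "mfps_coeff (F * g) (m + ?s) =
      (\<Sum>(a, b)\<in>{(a, b). a + b = m + ?s \<and> Poly_Mapping.lookup a v \<noteq> 0}. mfps_coeff F a * mfps_coeff g b)"
    unfolding coeff_mult
    by (rule sum.mono_neutral_right) (auto simp: finite_mfps_splittings assms intro!: gr0I)
  also have "\<dots> = (\<Sum>(a, b)\<in>{(a, b). a + b = m}. mfps_coeff F (a + ?s) * mfps_coeff g b)"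
  proof (rule sum.reindex_bij_witness[of _ "\<lambda>(a, b). (a + ?s, b)" "\<lambda>(a, b). (a - ?s, b)"])
    fix p assume "p \<in> {(a, b). a + b = m + ?s \<and> Poly_Mapping.lookup a v \<noteq> 0}"
    then obtain a b where p: "p = (a, b)" "a + b = m + ?s" "Poly_Mapping.lookup a v \<noteq> 0" by auto
    have "(a - ?s + b) + ?s = m + ?s"
      using cancel[OF p(3)] p(2) by (metis add.assoc add.commute)
    then have "a - ?s + b = m" by simp
    then show "(case p of (a, b) \<Rightarrow> (a - ?s, b)) \<in> {(a, b). a + b = m}"
      using p by simp
    show "(case case p of (a, b) \<Rightarrow> (a - ?s, b) of (a, b) \<Rightarrow> (a + ?s, b)) = p"
      using p cancel by simp
    show "(case case p of (a, b) \<Rightarrow> (a - ?s, b) of (a, b) \<Rightarrow> mfps_coeff F (a + ?s) * mfps_coeff g b) =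
        (case p of (a, b) \<Rightarrow> mfps_coeff F a * mfps_coeff g b)"
      using p cancel by simp
  next
    fix p assume "p \<in> {(a, b). a + b = m}"
    then show "(case p of (a, b) \<Rightarrow> (a + ?s, b)) \<in> {(a, b). a + b = m + ?s \<and> Poly_Mapping.lookup a v \<noteq> 0}"
      by (auto simp: lookup_add ac_simps)
  qed auto
  finally show ?thesis .
qed

text \<open>The product rule for partial derivatives follows from the one for the Euler operator
  \<open>v * \<partial>/\<partial>v\<close> by dividing by \<open>v\<close>, which the shift lemma performs on coefficients.\<close>

lemma deriv_mult:
  fixes f g :: "('v, 'a::comm_ring_1) mfps"
  shows "mfps_deriv v (f * g) = mfps_deriv v f * g + f * mfps_deriv v g"
proof (rule mfps_eqI)
  fix m
  interpret weight "\<lambda>m. Poly_Mapping.lookup m v"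
    by unfold_locales (simp add: lookup_add)
  let ?E = "mfps_euler (\<lambda>m. Poly_Mapping.lookup m v) :: ('v, 'a) mfps \<Rightarrow> ('v, 'a) mfps"
  let ?s = "Poly_Mapping.single v (1::nat)"
  have shift: "mfps_coeff (?E f * g) (m + ?s) = mfps_coeff (mfps_deriv v f * g) m" for f g :: "('v, 'a) mfps"
    by (subst coeff_mult_shift) (simp_all only: coeff_mult deriv_eq_euler, simp_all)
  show "mfps_coeff (mfps_deriv v (f * g)) m = mfps_coeff (mfps_deriv v f * g + f * mfps_deriv v g) m"
    unfolding deriv_eq_euler[of v "f * g"] euler_mult
    using shift[of f g] shift[of g f] by (simp add: mult.commute)
qed

lemma deriv_local_derivation: "local_derivation (mfps_deriv v)"
proof
  show "local_op (mfps_deriv v)"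
    by (rule local_opI[of "\<lambda>m. {m + Poly_Mapping.single v 1}"]) (simp_all add: coeff_deriv)
  show "mfps_deriv v (mfps_const c) = 0" for c
  proof (rule mfps_eqI)
    fix m
    have "Poly_Mapping.lookup (m + Poly_Mapping.single v (1::nat)) v \<noteq> 0"
      by (simp add: lookup_add)
    then have "m + Poly_Mapping.single v 1 \<noteq> 0" by force
    then show "mfps_coeff (mfps_deriv v (mfps_const c)) m = mfps_coeff 0 m"
      by (simp add: coeff_deriv coeff_const)
  qed
  show "mfps_deriv v (f + g) = mfps_deriv v f + mfps_deriv v g" for f g
    by (rule mfps_eqI) (simp add: coeff_deriv distrib_left)
qed (rule deriv_mult)

lemma deriv_var: "mfps_deriv v (mfps_var u) = (if u = v then 1 else 0)"
proof (rule mfps_eqI)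
  fix m
  show "mfps_coeff (mfps_deriv v (mfps_var u)) m = mfps_coeff (if u = v then 1 else 0) m"
  proof (cases "u = v")
    case True
    then show ?thesis by (simp add: coeff_deriv coeff_var coeff_one)
  next
    case False
    have "Poly_Mapping.lookup (m + Poly_Mapping.single v 1) v \<noteq> Poly_Mapping.lookup (Poly_Mapping.single u (1::nat)) v"
      using False by (simp add: lookup_add lookup_single)
    then have "m + Poly_Mapping.single v 1 \<noteq> Poly_Mapping.single u 1" by metis
    then show ?thesis using False by (simp add: coeff_deriv coeff_var)
  qed
qed

lemma vector_field_local_derivation: "local_derivation (vector_field w)"
proof -
  have "vector_field w = (\<lambda>f. \<Sum>v\<in>UNIV. w v * mfps_deriv v f)"
    by (rule ext) (rule vector_field_def)
  then show ?thesis
    by (simp add: local_derivation_sum local_derivation_scale deriv_local_derivation)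
qed

lemma vector_field_var [simp]: "vector_field w (mfps_var v) = w v"
  by (simp add: vector_field_def deriv_var if_distrib cong: if_cong)

lemma euler_var: "mfps_euler w (mfps_var v) = of_nat (w (Poly_Mapping.single v 1)) * mfps_var v"
  by (rule mfps_eqI) (simp add: of_nat_eq_const coeff_var)

text \<open>The grading may take values in any type, such as functions \<open>'n \<Rightarrow> nat\<close> for a multigrading.\<close>

definition homogeneous_part ::
    "(('v \<Rightarrow>\<^sub>0 nat) \<Rightarrow> 'g) \<Rightarrow> 'g \<Rightarrow> ('v, 'a::zero) mfps \<Rightarrow> ('v, 'a) mfps"
  where "homogeneous_part dg r f = Abs_mfps (\<lambda>m. if dg m = r then mfps_coeff f m else 0)"

lemma coeff_homogeneous_part [simp]:
  "mfps_coeff (homogeneous_part dg r f) m = (if dg m = r then mfps_coeff f m else 0)"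
  by (simp add: homogeneous_part_def Abs_mfps_inverse)

lemma has_sum_homogeneous_parts: "mfps_has_sum (\<lambda>r. homogeneous_part dg r f) f"
  unfolding mfps_has_sum_def
proof
  fix m
  have sub: "{r. mfps_coeff (homogeneous_part dg r f) m \<noteq> 0} \<subseteq> {dg m}" by auto
  then have "(\<Sum>r | mfps_coeff (homogeneous_part dg r f) m \<noteq> 0. mfps_coeff (homogeneous_part dg r f) m)
      = (\<Sum>r\<in>{dg m}. mfps_coeff (homogeneous_part dg r f) m)"
    by (intro sum.mono_neutral_left) auto
  then show "finite {r. mfps_coeff (homogeneous_part dg r f) m \<noteq> 0} \<and> mfps_coeff f m =
      (\<Sum>r | mfps_coeff (homogeneous_part dg r f) m \<noteq> 0. mfps_coeff (homogeneous_part dg r f) m)"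
    using finite_subset[OF sub] by simp
qed

definition homogeneous :: "(('v \<Rightarrow>\<^sub>0 nat) \<Rightarrow> 'g) \<Rightarrow> 'g \<Rightarrow> ('v, 'a::zero) mfps \<Rightarrow> bool" where
  "homogeneous dg r f \<longleftrightarrow> (\<forall>m. mfps_coeff f m \<noteq> 0 \<longrightarrow> dg m = r)"

locale multigrading =
  fixes dg :: "('v \<Rightarrow>\<^sub>0 nat) \<Rightarrow> 'n \<Rightarrow> nat"
  assumes dg_add: "dg (a + b) = (\<lambda>i. dg a i + dg b i)"
begin

lemma dg_zero: "dg 0 = (\<lambda>_. 0)"
proof
  fix i
  have "dg (0 + 0) i = dg 0 i + dg 0 i" by (simp only: dg_add)
  then show "dg 0 i = 0" by simp
qed

lemma homogeneous_var: "homogeneous dg (dg (Poly_Mapping.single v 1)) (mfps_var v)"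
  by (simp add: homogeneous_def coeff_var)

lemma homogeneous_mult:
  assumes "homogeneous dg r f" "homogeneous dg s g"
  shows "homogeneous dg (\<lambda>i. r i + s i) (f * g)"
  unfolding homogeneous_def
proof (intro allI impI)
  fix m assume "mfps_coeff (f * g) m \<noteq> 0"
  then obtain a b where "a + b = m" "mfps_coeff f a \<noteq> 0" "mfps_coeff g b \<noteq> 0"
    by (rule coeff_mult_nonzero)
  then show "dg m = (\<lambda>i. r i + s i)"
    using assms dg_add[of a b] by (simp add: homogeneous_def)
qed

lemma homogeneous_add: "homogeneous dg r f \<Longrightarrow> homogeneous dg r g \<Longrightarrow> homogeneous dg r (f + g)"
  unfolding homogeneous_def by (metis add.right_neutral coeff_add)

lemma homogeneous_part_0_mult:
  "homogeneous_part dg (\<lambda>_. 0) (f * g) = homogeneous_part dg (\<lambda>_. 0) f * homogeneous_part dg (\<lambda>_. 0) g"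
proof (rule mfps_eqI)
  fix m
  have split: "dg a = (\<lambda>_. 0) \<and> dg b = (\<lambda>_. 0) \<longleftrightarrow> dg m = (\<lambda>_. 0)" if "a + b = m" for a b
    using dg_add[of a b] that by (auto simp: fun_eq_iff)
  show "mfps_coeff (homogeneous_part dg (\<lambda>_. 0) (f * g)) m =
      mfps_coeff (homogeneous_part dg (\<lambda>_. 0) f * homogeneous_part dg (\<lambda>_. 0) g) m"
  proof (cases "dg m = (\<lambda>_. 0)")
    case True
    have "mfps_coeff (homogeneous_part dg (\<lambda>_. 0) f * homogeneous_part dg (\<lambda>_. 0) g) m =
        (\<Sum>(a, b)\<in>{(a, b). a + b = m}. mfps_coeff f a * mfps_coeff g b)"
      unfolding coeff_mult
    proof (rule sum.cong[OF refl], clarify)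
      fix a b assume "m = a + b"
      then show "mfps_coeff (homogeneous_part dg (\<lambda>_. 0) f) a * mfps_coeff (homogeneous_part dg (\<lambda>_. 0) g) b
          = mfps_coeff f a * mfps_coeff g b"
        using split[of a b] True by simp
    qed
    then show ?thesis using True by (simp add: coeff_mult)
  next
    case False
    have "mfps_coeff (homogeneous_part dg (\<lambda>_. 0) f * homogeneous_part dg (\<lambda>_. 0) g) m = 0"
      unfolding coeff_mult
    proof (rule sum.neutral, clarify)
      fix a b assume "m = a + b"
      then show "mfps_coeff (homogeneous_part dg (\<lambda>_. 0) f) a * mfps_coeff (homogeneous_part dg (\<lambda>_. 0) g) b = 0"
        using split[of a b] False by auto
    qed
    then show ?thesis using False by simp
  qed
qed

lemma homogeneous_part_mult:
  assumes "homogeneous dg e c"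
  shows "homogeneous_part dg (\<lambda>i. r i + e i) (c * f) = c * homogeneous_part dg r f"
proof (rule mfps_eqI)
  fix m
  have "mfps_coeff c a * mfps_coeff (homogeneous_part dg r f) b =
      (if dg m = (\<lambda>i. r i + e i) then mfps_coeff c a * mfps_coeff f b else 0)" if "a + b = m" for a b
  proof (cases "mfps_coeff c a = 0")
    case False
    then have "dg m = (\<lambda>i. dg b i + e i)"
      using assms dg_add[of a b] that by (auto simp: homogeneous_def)
    then have "dg m = (\<lambda>i. r i + e i) \<longleftrightarrow> dg b = r" by (auto simp: fun_eq_iff)
    then show ?thesis by simp
  qed simp
  then have "mfps_coeff (c * homogeneous_part dg r f) m =
      (\<Sum>(a, b)\<in>{(a, b). a + b = m}. if dg m = (\<lambda>i. r i + e i) then mfps_coeff c a * mfps_coeff f b else 0)"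
    unfolding coeff_mult by (intro sum.cong) auto
  then show "mfps_coeff (homogeneous_part dg (\<lambda>i. r i + e i) (c * f)) m =
      mfps_coeff (c * homogeneous_part dg r f) m"
    by (simp add: coeff_mult)
qed

lemma homogeneous_part_mult_deriv:
  assumes "homogeneous dg (\<lambda>i. dg (Poly_Mapping.single v 1) i + e i) c"
  shows "homogeneous_part dg (\<lambda>i. r i + e i) (c * mfps_deriv v f) = c * mfps_deriv v (homogeneous_part dg r f)"
proof (rule mfps_eqI)
  fix m
  have "mfps_coeff c a * mfps_coeff (mfps_deriv v (homogeneous_part dg r f)) b =
      (if dg m = (\<lambda>i. r i + e i) then mfps_coeff c a * mfps_coeff (mfps_deriv v f) b else 0)" if "a + b = m" for a b
  proof (cases "mfps_coeff c a = 0")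
    case False
    then have "dg m = (\<lambda>i. dg (b + Poly_Mapping.single v 1) i + e i)"
      using assms dg_add[of a b] dg_add[of b "Poly_Mapping.single v 1"] that
      by (auto simp: homogeneous_def fun_eq_iff)
    then have "dg m = (\<lambda>i. r i + e i) \<longleftrightarrow> dg (b + Poly_Mapping.single v 1) = r" by (auto simp: fun_eq_iff)
    then show ?thesis by (simp add: coeff_deriv)
  qed simp
  then have "mfps_coeff (c * mfps_deriv v (homogeneous_part dg r f)) m =
      (\<Sum>(a, b)\<in>{(a, b). a + b = m}. if dg m = (\<lambda>i. r i + e i) then mfps_coeff c a * mfps_coeff (mfps_deriv v f) b else 0)"
    unfolding coeff_mult by (intro sum.cong) auto
  then show "mfps_coeff (homogeneous_part dg (\<lambda>i. r i + e i) (c * mfps_deriv v f)) m =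
      mfps_coeff (c * mfps_deriv v (homogeneous_part dg r f)) m"
    by (simp add: coeff_mult)
qed

end

lemma homogeneous_part_add: "homogeneous_part dg r (f + g) = homogeneous_part dg r f + homogeneous_part dg r (g :: ('v, 'a::comm_ring_1) mfps)"
  by (rule mfps_eqI) simp

lemma homogeneous_part_sum:
  fixes f :: "'i \<Rightarrow> ('v, 'a::comm_ring_1) mfps"
  shows "homogeneous_part dg r (\<Sum>i\<in>I. f i) = (\<Sum>i\<in>I. homogeneous_part dg r (f i))"
  by (rule mfps_eqI) simp

text \<open>The partial derivative by \<open>v\<close> lowers the degree by that of \<open>v\<close>, and its coefficient \<open>u v\<close>
  raises it by \<open>e\<close> more than that.\<close>

lemma homogeneous_part_vector_field:
  fixes u :: "'v::finite \<Rightarrow> ('v, 'a::comm_ring_1) mfps"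
  assumes "multigrading dg"
    and "\<And>v. homogeneous dg (\<lambda>i. dg (Poly_Mapping.single v 1) i + e i) (u v)"
  shows "homogeneous_part dg (\<lambda>i. r i + e i) (vector_field u f) = vector_field u (homogeneous_part dg r f)"
  unfolding vector_field_def homogeneous_part_sum multigrading.homogeneous_part_mult_deriv[OF assms] ..

section \<open>Derivatives of the inverse and of the logarithm of the determinant\<close>

definition map_matrix_entries :: "('a \<Rightarrow> 'b) \<Rightarrow> 'a^'n^'m \<Rightarrow> 'b^'n^'m" where
  "map_matrix_entries d A = (\<chi> i j. d (A $ i $ j))"

lemma map_matrix_entries_nth [simp]: "map_matrix_entries d A $ i $ j = d (A $ i $ j)"
  by (simp add: map_matrix_entries_def)

lemma matrix_mult_nth: "(A ** B) $ i $ j = (\<Sum>k\<in>UNIV. A $ i $ k * B $ k $ j)"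
  by (simp add: matrix_matrix_mult_def)

lemma matrix_sub_ldistrib: "A ** (B - C) = A ** B - A ** (C :: 'a::ring_1^'n^'m)"
  by (simp add: vec_eq_iff matrix_mult_nth right_diff_distrib sum_subtractf)

lemma matrix_sub_rdistrib: "(A - B) ** C = A ** C - B ** (C :: 'a::ring_1^'n^'m)"
  by (simp add: vec_eq_iff matrix_mult_nth left_diff_distrib sum_subtractf)

lemma matrix_power_Suc_right: "matrix_power A (Suc k) = matrix_power A k ** A"
  by (induction k) (simp_all add: matrix_mul_assoc matrix_mul_lid matrix_mul_rid)

lemma (in derivation) matrix_mult:
  "map_matrix_entries d (A ** B) = map_matrix_entries d A ** B + A ** map_matrix_entries d B"
  by (simp add: vec_eq_iff matrix_mult_nth sum mult sum.distrib)

lemma (in derivation) matrix_add: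
  "map_matrix_entries d (A + B) = map_matrix_entries d A + map_matrix_entries d B"
  by (simp add: vec_eq_iff add)

lemma (in derivation) matrix_mat_1: "map_matrix_entries d (mat 1) = 0"
  by (simp add: vec_eq_iff mat_def zero one)

lemma (in derivation) trace:
  "d (trace A) = trace (map_matrix_entries d A)"
  by (simp add: trace_def sum)

text \<open>The trace is cyclic, so in \<open>trace (d (A\<^sup>k\<^sup>+\<^sup>1))\<close> all \<open>k + 1\<close> positions of \<open>d A\<close> give the
  same value. The additional factor \<open>B\<close>, which commutes with \<open>A\<close>, makes the induction work.\<close>

lemma (in derivation) trace_mult_power:
  assumes "B ** A = A ** B"
  shows "trace (B ** map_matrix_entries d (matrix_power A (Suc k))) =
    of_nat (Suc k) * trace (B ** matrix_power A k ** map_matrix_entries d A)"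
  using assms
proof (induction k arbitrary: B)
  case 0
  then show ?case by (simp add: matrix_mul_rid)
next
  case (Suc k)
  let ?d = "map_matrix_entries d" and ?P = "matrix_power A"
  have comm: "B ** ?P j = ?P j ** B" for j
    by (induction j) (simp_all add: matrix_mul_rid matrix_mul_lid matrix_mul_assoc Suc.prems,
      metis matrix_mul_assoc)
  have "trace (B ** ?d (?P (Suc (Suc k)))) =
      trace (B ** (?d A ** ?P (Suc k))) + trace (B ** (A ** ?d (?P (Suc k))))"
    by (simp only: matrix_power.simps(2)[of A "Suc k"] matrix_mult matrix_add_ldistrib trace_add)
  also have "trace (B ** (?d A ** ?P (Suc k))) = trace (B ** ?P (Suc k) ** ?d A)"
    by (metis comm matrix_mul_assoc trace_mul_sym)
  also have "trace (B ** (A ** ?d (?P (Suc k)))) = of_nat (Suc k) * trace ((B ** A) ** ?P k ** ?d A)"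
    unfolding matrix_mul_assoc[of B A]
    by (rule Suc.IH) (metis Suc.prems matrix_mul_assoc)
  also have "(B ** A) ** ?P k = B ** ?P (Suc k)"
    by (simp add: matrix_mul_assoc)
  finally show ?case by (simp add: algebra_simps)
qed

context weight
begin

lemma vanishes_below_matrix_power:
  fixes A :: "('v, 'a::comm_ring_1) mfps^'n^'n"
  assumes "\<And>i j. vanishes_below 1 (A $ i $ j)"
  shows "vanishes_below k (matrix_power A k $ i $ j)"
proof (induction k arbitrary: i j)
  case (Suc k)
  have "vanishes_below (1 + k) (A $ i $ l * matrix_power A k $ l $ j)" for l
    using assms Suc.IH by (rule vanishes_below_mult)
  then show ?case by (simp add: matrix_mult_nth vanishes_below_sum)
qed simp

context
  fixes A :: "('v, 'a::comm_ring_1) mfps^'n^'n"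
  assumes A: "\<And>i j. vanishes_below 1 (A $ i $ j)"
begin

lemma inv_one_minus_has_sum:
  "mfps_has_sum (\<lambda>k. matrix_power A k $ i $ j) (inv_one_minus A $ i $ j)"
  using has_sum_vanishing[OF vanishes_below_matrix_power[OF A]] by (simp add: inv_one_minus_def)

text \<open>The geometric series, split after its first term.\<close>

lemma inv_one_minus_unfold_left: "inv_one_minus A = mat 1 + A ** inv_one_minus A"
proof -
  have "inv_one_minus A $ i $ j = (mat 1 + A ** inv_one_minus A) $ i $ j" for i j
  proof -
    have "mfps_has_sum (\<lambda>k. \<Sum>l\<in>UNIV. A $ i $ l * matrix_power A k $ l $ j)
        (\<Sum>l\<in>UNIV. A $ i $ l * inv_one_minus A $ l $ j)"
      by (intro has_sum_sum has_sum_mult inv_one_minus_has_sum)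
    then have "mfps_has_sum (\<lambda>k. matrix_power A (Suc k) $ i $ j) ((A ** inv_one_minus A) $ i $ j)"
      by (simp add: matrix_mult_nth)
    then have "mfps_has_sum (\<lambda>k. matrix_power A k $ i $ j)
        (matrix_power A 0 $ i $ j + (A ** inv_one_minus A) $ i $ j)"
      by (rule has_sum_Suc)
    then show ?thesis
      using has_sum_unique[OF inv_one_minus_has_sum] by simp
  qed
  then show ?thesis unfolding vec_eq_iff by blast
qed

lemma inv_one_minus_unfold_right: "inv_one_minus A = mat 1 + inv_one_minus A ** A"
proof -
  have "inv_one_minus A $ i $ j = (mat 1 + inv_one_minus A ** A) $ i $ j" for i j
  proof -
    have "mfps_has_sum (\<lambda>k. \<Sum>l\<in>UNIV. A $ l $ j * matrix_power A k $ i $ l)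
        (\<Sum>l\<in>UNIV. A $ l $ j * inv_one_minus A $ i $ l)"
      by (intro has_sum_sum has_sum_mult inv_one_minus_has_sum)
    then have "mfps_has_sum (\<lambda>k. matrix_power A (Suc k) $ i $ j) ((inv_one_minus A ** A) $ i $ j)"
      unfolding matrix_power_Suc_right by (simp add: matrix_mult_nth mult.commute)
    then have "mfps_has_sum (\<lambda>k. matrix_power A k $ i $ j)
        (matrix_power A 0 $ i $ j + (inv_one_minus A ** A) $ i $ j)"
      by (rule has_sum_Suc)
    then show ?thesis
      using has_sum_unique[OF inv_one_minus_has_sum] by simp
  qed
  then show ?thesis unfolding vec_eq_iff by blast
qed

context
  fixes d :: "('v, 'a) mfps \<Rightarrow> ('v, 'a) mfps" and i :: 'n
  assumes d: "local_derivation d"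
    and dA: "\<And>j k. d (A $ j $ k) = (mat 1 - A) $ j $ i * A $ i $ k"
begin

interpretation local_derivation d by (rule d)

text \<open>With \<open>K = 1 - A\<close> and \<open>G\<close> its inverse, \<open>d G = G ** d A ** G\<close>. The assumption on \<open>d\<close> says that
  \<open>d A = K ** R\<close>, where the row \<open>i\<close> of \<open>R\<close> is that of \<open>A\<close> and all its other rows vanish;
  hence \<open>d G = R ** G\<close>.\<close>

lemma derivation_inv_one_minus:
  "d (inv_one_minus A $ j $ k) = (if j = i then (A ** inv_one_minus A) $ i $ k else 0)"
proof -
  let ?G = "inv_one_minus A" and ?d = "map_matrix_entries d" and ?K = "mat 1 - A"
  let ?R = "\<chi> j k. if j = i then A $ i $ k else 0"
  have GK: "?G ** ?K = mat 1"
    using inv_one_minus_unfold_right by (simp add: matrix_sub_ldistrib matrix_mul_rid algebra_simps)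
  have dA': "?d A = ?K ** ?R"
    by (simp add: vec_eq_iff matrix_mult_nth dA if_distrib cong: if_cong)
  have "?d ?G = ?d (mat 1 + A ** ?G)"
    by (rule arg_cong[OF inv_one_minus_unfold_left])
  also have "\<dots> = ?d A ** ?G + A ** ?d ?G"
    by (simp add: matrix_add matrix_mult matrix_mat_1)
  finally have "?K ** ?d ?G = ?K ** ?R ** ?G"
    by (simp add: matrix_sub_rdistrib matrix_mul_lid dA' algebra_simps)
  then have "?G ** (?K ** ?d ?G) = ?G ** (?K ** ?R ** ?G)" by simp
  then have "?d ?G = ?R ** ?G"
    by (simp add: matrix_mul_assoc GK matrix_mul_lid)
  then have "?d ?G $ j $ k = (?R ** ?G) $ j $ k" by simp
  then show ?thesis
    by (simp add: matrix_mult_nth)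
qed

text \<open>The derivatives of the row vector \<open>u\<close> and of the inverse matrix cancel, and the one of the
  column vector \<open>v\<close> cancels the factor \<open>1 - A\<close> against its inverse.\<close>

lemma derivation_bilinear:
  assumes u: "\<And>j. d (u j) = - u i * A $ i $ j"
    and v: "\<And>j. d (v j) = (mat 1 - A) $ j $ i * v i"
  shows "d (\<Sum>j\<in>UNIV. \<Sum>k\<in>UNIV. u j * inv_one_minus A $ j $ k * v k) = u i * v i"
proof -
  let ?G = "inv_one_minus A"
  have "d (\<Sum>j\<in>UNIV. \<Sum>k\<in>UNIV. u j * ?G $ j $ k * v k) =
      (\<Sum>j\<in>UNIV. \<Sum>k\<in>UNIV. d (u j) * ?G $ j $ k * v k)
      + (\<Sum>j\<in>UNIV. \<Sum>k\<in>UNIV. u j * d (?G $ j $ k) * v k)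
      + (\<Sum>j\<in>UNIV. \<Sum>k\<in>UNIV. u j * ?G $ j $ k * d (v k))"
    by (simp add: sum mult sum.distrib algebra_simps)
  also have "(\<Sum>j\<in>UNIV. \<Sum>k\<in>UNIV. d (u j) * ?G $ j $ k * v k) =
      - u i * (\<Sum>k\<in>UNIV. (A ** ?G) $ i $ k * v k)"
    unfolding u matrix_mult_nth sum_distrib_left sum_distrib_right
    by (subst sum.swap) (simp add: algebra_simps)
  also have "(\<Sum>j\<in>UNIV. \<Sum>k\<in>UNIV. u j * d (?G $ j $ k) * v k) =
      (\<Sum>j\<in>UNIV. if j = i then u i * (\<Sum>k\<in>UNIV. (A ** ?G) $ i $ k * v k) else 0)"
    unfolding derivation_inv_one_minus by (rule sum.cong) (auto simp: sum_distrib_left mult.assoc)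
  also have "\<dots> = u i * (\<Sum>k\<in>UNIV. (A ** ?G) $ i $ k * v k)" by simp
  also have "(\<Sum>j\<in>UNIV. \<Sum>k\<in>UNIV. u j * ?G $ j $ k * d (v k)) =
      (\<Sum>j\<in>UNIV. u j * (?G ** (mat 1 - A)) $ j $ i * v i)"
    unfolding v matrix_mult_nth by (simp add: sum_distrib_left sum_distrib_right mult.assoc)
  also have "?G ** (mat 1 - A) = mat 1"
    using inv_one_minus_unfold_right by (simp add: matrix_sub_ldistrib matrix_mul_rid algebra_simps)
  also have "(\<Sum>j\<in>UNIV. u j * (mat 1 :: ('v, 'a) mfps^'n^'n) $ j $ i * v i) = u i * v i"
    by (simp add: mat_def if_distrib if_distribR cong: if_cong)
  finally show ?thesis by simp
qed

end

end

lemma log_det_has_sum: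
  fixes A :: "('v, 'a::field_char_0) mfps^'n^'n"
  assumes A: "\<And>i j. vanishes_below 1 (A $ i $ j)"
  defines "F \<equiv> \<lambda>t. mfps_const (1 / of_nat (Suc t)) * trace (matrix_power A (Suc t))"
  shows "mfps_has_sum F (mfps_sum F)" and "vanishes_below 1 (mfps_sum F)"
proof -
  have "vanishes_below (Suc t) (trace (matrix_power A (Suc t)))" for t
    unfolding trace_def by (intro vanishes_below_sum vanishes_below_matrix_power A)
  then have F: "vanishes_below (Suc t) (F t)" for t
    using vanishes_below_mult[OF vanishes_below_0] unfolding F_def by (metis add_0)
  then have "vanishes_below t (F t)" for t
    unfolding vanishes_below_def by (meson less_SucI)
  then show *: "mfps_has_sum F (mfps_sum F)"
    by (rule has_sum_vanishing)
  have "vanishes_below 1 (F t)" for t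
    using F[of t] unfolding vanishes_below_def by simp
  with * show "vanishes_below 1 (mfps_sum F)"
    by (rule vanishes_below_mfps_sum)
qed

text \<open>Here \<open>d (trace (A\<^sup>t\<^sup>+\<^sup>1)) / (t + 1) = trace (A\<^sup>t ** d A)\<close> is the diagonal entry at \<open>i\<close> of
  \<open>A\<^sup>t\<^sup>+\<^sup>1 - A\<^sup>t\<^sup>+\<^sup>2\<close>, so that the series telescopes to its first term.\<close>

lemma derivation_log_det:
  fixes A :: "('v, 'a::field_char_0) mfps^'n^'n"
  assumes A: "\<And>i j. vanishes_below 1 (A $ i $ j)"
    and d: "local_derivation d"
    and dA: "\<And>j k. d (A $ j $ k) = (mat 1 - A) $ j $ i * A $ i $ k"
  shows "d (mfps_sum (\<lambda>t. mfps_const (1 / of_nat (Suc t)) * trace (matrix_power A (Suc t)))) = A $ i $ i"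
proof -
  interpret local_derivation d by fact
  let ?F = "\<lambda>t. mfps_const (1 / of_nat (Suc t)) * trace (matrix_power A (Suc t))"
  let ?g = "\<lambda>t. matrix_power A (Suc t) $ i $ i"
  have "d (?F t) = ?g t - ?g (Suc t)" for t
  proof -
    let ?P = "matrix_power A"
    have "d (trace (?P (Suc t))) = of_nat (Suc t) * trace (?P t ** map_matrix_entries d A)"
      using trace_mult_power[of "mat 1" A t] by (simp add: trace matrix_mul_lid matrix_mul_rid)
    also have "trace (?P t ** map_matrix_entries d A) =
        (\<Sum>j\<in>UNIV. (\<Sum>k\<in>UNIV. ?P t $ j $ k * (mat 1 - A) $ k $ i) * A $ i $ j)"
      by (simp add: trace_def matrix_mult_nth dA sum_distrib_right mult.assoc)
    also have "\<dots> = (A ** (?P t ** (mat 1 - A))) $ i $ i"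
      by (simp add: matrix_mult_nth mult.commute)
    also have "A ** (?P t ** (mat 1 - A)) = ?P (Suc t) - ?P (Suc (Suc t))"
      by (simp only: matrix_power_Suc_right[of A "Suc t"])
        (simp add: matrix_sub_ldistrib matrix_mul_assoc)
    finally have "d (trace (?P (Suc t))) = of_nat (Suc t) * (?g t - ?g (Suc t))" by simp
    moreover have "mfps_const (1 / of_nat (Suc t)) * of_nat (Suc t) = (1 :: ('v, 'a) mfps)"
      unfolding of_nat_eq_const mfps_const_mult[symmetric] by (simp del: of_nat_Suc)
    ultimately show ?thesis
      unfolding const_mult by (simp only: mult.assoc[symmetric]) simp
  qed
  moreover have "mfps_has_sum (\<lambda>t. ?g t - ?g (Suc t)) (?g 0)"
  proof (rule has_sum_telescope)
    fix m
    have "mfps_coeff (?g k) m = 0" if "k \<ge> w m" for k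
      using vanishes_below_matrix_power[OF A, of "Suc k" i i] that
      unfolding vanishes_below_def by (meson le_imp_less_Suc)
    then show "\<exists>N. \<forall>k\<ge>N. mfps_coeff (?g k) m = 0" by blast
  qed
  ultimately have "mfps_has_sum (\<lambda>t. d (?F t)) (A $ i $ i)"
    by (simp add: matrix_mul_rid)
  then show ?thesis
    by (rule has_sum_unique[OF has_sum[OF log_det_has_sum(1)[OF A]]])
qed

end

section \<open>Transport of permanents along homomorphisms and relabellings\<close>

lemma ext_pperm_hom:
  assumes h: "h 1 = 1" "\<And>x y. h (x * y) = h x * h y" "h 0 = 0" "\<And>x y. h (x + y) = h x + h y"
  shows "h (ext_pperm \<beta> \<theta> \<phi> X M) = ext_pperm (h \<beta>) (\<lambda>x. h (\<theta> x)) (\<lambda>x. h (\<phi> x)) X (\<lambda>x y. h (M x y))"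
proof -
  have prod: "h (\<Prod>i\<in>I. f i) = (\<Prod>i\<in>I. h (f i))" for f :: "'x \<Rightarrow> _" and I
    by (induction I rule: infinite_finite_induct) (simp_all add: h)
  have sum: "h (\<Sum>i\<in>I. f i) = (\<Sum>i\<in>I. h (f i))" for f :: "('x \<Rightarrow> 'x option) \<Rightarrow> _" and I
    by (induction I rule: infinite_finite_induct) (simp_all add: h)
  have power: "h (x ^ k) = h x ^ k" for x k
    by (induction k) (simp_all add: h)
  show ?thesis
    unfolding ext_pperm_def by (simp add: sum prod power h(2))
qed

text \<open>Relabelling conjugates a partial permutation, which preserves its cycles and its arcs.\<close>

lemma ext_pperm_image:
  assumes g: "inj g" and fin: "finite X"
  shows "ext_pperm \<beta> \<theta> \<phi> (g ` X) M = ext_pperm \<beta> (\<lambda>x. \<theta> (g x)) (\<lambda>x. \<phi> (g x)) X (\<lambda>x y. M (g x) (g y))"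
proof -
  \<comment> \<open>Conjugation of a partial map by \<open>g\<close>, and its inverse.\<close>
  define push where "push \<psi> = (\<lambda>y. if y \<in> range g then map_option g (\<psi> (inv g y)) else None)" for \<psi>
  define pull where "pull \<psi> = (\<lambda>x. map_option (inv g) (\<psi> (g x)))" for \<psi>
  have inv: "inv g (g x) = x" for x using g by (rule inv_f_f)
  have push_g [simp]: "push \<psi> (g x) = map_option g (\<psi> x)" for \<psi> x
    by (simp add: push_def inv)
  have push_Some: "push \<psi> a = Some b \<longleftrightarrow> (\<exists>x y. a = g x \<and> b = g y \<and> \<psi> x = Some y)" for \<psi> a b
    by (auto simp: push_def inv)
  have dom: "dom (push \<psi>) = g ` dom \<psi>" and ran: "ran (push \<psi>) = g ` ran \<psi>" for \<psi>
    by (auto simp: dom_def ran_def push_Some)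
  have push_in: "push \<psi> \<in> partial_perms (g ` X)" if "\<psi> \<in> partial_perms X" for \<psi>
  proof (rule partial_permI)
    show "a \<in> g ` X \<and> b \<in> g ` X" if "push \<psi> a = Some b" for a b
      using that partial_permD(6,7)[OF \<open>\<psi> \<in> partial_perms X\<close>] by (auto simp: push_Some)
    show "a = b" if "push \<psi> a = Some c" "push \<psi> b = Some c" for a b c
      using that partial_permD(3)[OF \<open>\<psi> \<in> partial_perms X\<close>] injD[OF g] unfolding push_Some by metis
  qed
  have cycles: "pperm_cycles (push \<psi>) = pperm_cycles \<psi>" if \<psi>: "\<psi> \<in> partial_perms X" for \<psi>
  proof -
    let ?f = "\<lambda>x. the (\<psi> x)" and ?f' = "\<lambda>x. the (push \<psi> x)" and ?C = "pperm_core \<psi>"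
    have f': "?f' (g x) = g (?f x)" if "x \<in> dom \<psi>" for x using that by auto
    have core: "pperm_core (push \<psi>) = g ` ?C"
    proof (intro equalityI subsetI)
      fix b assume "b \<in> pperm_core (push \<psi>)"
      then obtain S where S: "S \<subseteq> g ` dom \<psi>" "b \<in> S" "\<forall>c\<in>S. ?f' c \<in> S"
        using pperm_core_iff[OF _ push_in[OF \<psi>]] fin dom by auto
      have sub: "g -` S \<subseteq> dom \<psi>" using S(1) injD[OF g] by blast
      obtain a where a: "b = g a" using S by blast
      have "\<forall>c\<in>g -` S. ?f c \<in> g -` S"
        using S(3) sub f' by fastforce
      then have "a \<in> ?C"
        using pperm_core_iff[OF fin \<psi>] sub S(2) a by blast
      then show "b \<in> g ` ?C" using a by simp
    next
      fix b assume "b \<in> g ` ?C"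
      moreover have "g ` ?C \<subseteq> dom (push \<psi>)" using pperm_core_subset[of \<psi>] dom by auto
      moreover have "\<forall>c\<in>g ` ?C. ?f' c \<in> g ` ?C"
        using f' pperm_core_subset[of \<psi>] pperm_core_closed[of _ \<psi>] by (metis (no_types, lifting) image_iff subsetD)
      ultimately show "b \<in> pperm_core (push \<psi>)"
        using pperm_core_iff[OF finite_imageI[OF fin] push_in[OF \<psi>]] by blast
    qed
    have orb: "orbit ?f' (g a) = g ` orbit ?f a" if a: "a \<in> ?C" for a
    proof (intro equalityI subsetI)
      have sub: "orbit ?f a \<subseteq> dom \<psi>"
        using orbit_subset_closed[OF a pperm_core_closed] pperm_core_subset by (rule subset_trans)
      have "a \<in> dom \<psi>" using a pperm_core_subset[of \<psi>] by auto
      show "b \<in> g ` orbit ?f a" if "b \<in> orbit ?f' (g a)" for b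
        using that
      proof induction
        case base
        show ?case
          unfolding f'[OF \<open>a \<in> dom \<psi>\<close>] by (rule imageI) (rule orbit.base)
      next
        case (step b)
        then obtain c where c: "b = g c" "c \<in> orbit ?f a" by blast
        then have "?f' b = g (?f c)" using f'[of c] sub by auto
        then show ?case by (simp only:) (rule imageI, rule orbit.step[OF c(2)])
      qed
      have *: "g c \<in> orbit ?f' (g a)" if "c \<in> orbit ?f a" for c
        using that
      proof induction
        case base
        show ?case
          unfolding f'[OF \<open>a \<in> dom \<psi>\<close>, symmetric] by (rule orbit.base)
      next
        case (step c)
        have "c \<in> dom \<psi>" using sub step(1) by (rule subsetD)
        show ?case
          unfolding f'[OF \<open>c \<in> dom \<psi>\<close>, symmetric] by (rule orbit.step[OF step(2)])
      qed
      show "b \<in> orbit ?f' (g a)" if "b \<in> g ` orbit ?f a" for b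
        using that * by blast
    qed
    have "orbit ?f' ` pperm_core (push \<psi>) = (`) g ` (orbit ?f ` ?C)"
      unfolding core image_image by (rule image_cong[OF refl orb])
    moreover have "inj_on ((`) g) (orbit ?f ` ?C)"
      by (rule inj_onI) (simp add: inj_image_eq_iff[OF g])
    ultimately show ?thesis
      unfolding pperm_cycles_def by (simp add: card_image)
  qed
  have inj_on: "inj_on g A" for A using g by (rule inj_on_subset) simp
  show ?thesis
    unfolding ext_pperm_def
  proof (rule sym, rule sum.reindex_bij_witness[of _ pull push])
    fix \<psi> assume \<psi>: "\<psi> \<in> partial_perms X"
    show "push \<psi> \<in> partial_perms (g ` X)" by (rule push_in[OF \<psi>])
    show "pull (push \<psi>) = \<psi>"
    proof
      fix x show "pull (push \<psi>) x = \<psi> x"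
        by (cases "\<psi> x") (simp_all add: pull_def inv)
    qed
    have "(\<Prod>x\<in>dom (push \<psi>). M x (the (push \<psi> x))) = (\<Prod>x\<in>dom \<psi>. M (g x) (g (the (\<psi> x))))"
      unfolding dom prod.reindex[OF inj_on] comp_def by (rule prod.cong) auto
    moreover have "(\<Prod>y\<in>g ` X - ran (push \<psi>). \<theta> y) = (\<Prod>y\<in>X - ran \<psi>. \<theta> (g y))"
      unfolding ran image_set_diff[OF g, symmetric] by (simp add: prod.reindex[OF inj_on] comp_def)
    moreover have "(\<Prod>z\<in>g ` X - dom (push \<psi>). \<phi> z) = (\<Prod>z\<in>X - dom \<psi>. \<phi> (g z))"
      unfolding dom image_set_diff[OF g, symmetric] by (simp add: prod.reindex[OF inj_on] comp_def)
    ultimately show "\<beta> ^ pperm_cycles (push \<psi>) * (\<Prod>x\<in>dom (push \<psi>). M x (the (push \<psi> x))) *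
        (\<Prod>y\<in>g ` X - ran (push \<psi>). \<theta> y) * (\<Prod>z\<in>g ` X - dom (push \<psi>). \<phi> z) =
        \<beta> ^ pperm_cycles \<psi> * (\<Prod>x\<in>dom \<psi>. M (g x) (g (the (\<psi> x)))) *
        (\<Prod>y\<in>X - ran \<psi>. \<theta> (g y)) * (\<Prod>z\<in>X - dom \<psi>. \<phi> (g z))"
      by (simp add: cycles[OF \<psi>])
  next
    fix \<psi> assume \<psi>: "\<psi> \<in> partial_perms (g ` X)"
    have pull_Some: "pull \<psi> x = Some y \<longleftrightarrow> \<psi> (g x) = Some (g y)" for x y
      using partial_permD(7)[OF \<psi>, of "g x"] by (auto simp: pull_def inv)
    show "pull \<psi> \<in> partial_perms X"
    proof (rule partial_permI)
      show "a \<in> X \<and> b \<in> X" if "pull \<psi> a = Some b" for a b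
        using partial_permD(6,7)[OF \<psi>, of "g a" "g b"] that injD[OF g] unfolding pull_Some by blast
      show "a = b" if "pull \<psi> a = Some c" "pull \<psi> b = Some c" for a b c
        using that partial_permD(3)[OF \<psi>, of "g a" "g c" "g b"] injD[OF g] unfolding pull_Some by blast
    qed
    show "push (pull \<psi>) = \<psi>"
    proof
      fix y
      show "push (pull \<psi>) y = \<psi> y"
      proof (cases "\<psi> y")
        case None
        then show ?thesis by (auto simp: push_def pull_def f_inv_into_f)
      next
        case (Some z)
        then obtain a b where "y = g a" "z = g b" using partial_permD(6,7)[OF \<psi> Some] by blast
        then show ?thesis using Some pull_Some[of a b] by simp
      qed
    qed
  qed
qed

section \<open>The grading by sources\<close>

instance indet :: (finite, finite) finite
proof
  have "(UNIV :: ('a, 'b) indet set) \<subseteq> {X\<beta>} \<union> range (\<lambda>(i, j). XA i j) \<union> range (\<lambda>(i, j). XB i j)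
      \<union> range (\<lambda>(i, j). XU i j) \<union> range (\<lambda>(i, j). XV i j) \<union> range X\<theta> \<union> range X\<phi> \<union> range X\<theta>' \<union> range X\<phi>'"
  proof
    fix v :: "('a, 'b) indet"
    show "v \<in> {X\<beta>} \<union> range (\<lambda>(i, j). XA i j) \<union> range (\<lambda>(i, j). XB i j)
      \<union> range (\<lambda>(i, j). XU i j) \<union> range (\<lambda>(i, j). XV i j) \<union> range X\<theta> \<union> range X\<phi> \<union> range X\<theta>' \<union> range X\<phi>'"
      by (cases v) auto
  qed
  then show "finite (UNIV :: ('a, 'b) indet set)"
    by (rule finite_subset) simp
qed

text \<open>In every term of the permanent, each copy of an index \<open>i\<close> contributes exactly one
  indeterminate in which it is the starting point of an arc (to another copy or to a primed index)
  or the end of a path. The number of these indeterminates in a monomial therefore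
  recovers the multiplicity of \<open>i\<close>.\<close>

primrec source :: "('n, 'm) indet \<Rightarrow> 'n option" where
  "source X\<beta> = None"
| "source (XA i j) = Some i"
| "source (XB i j) = None"
| "source (XU i j) = None"
| "source (XV i j) = Some i"
| "source (X\<theta> i) = None"
| "source (X\<phi> i) = Some i"
| "source (X\<theta>' i) = None"
| "source (X\<phi>' i) = None"

definition source_degree :: "(('n::finite, 'm::finite) indet \<Rightarrow>\<^sub>0 nat) \<Rightarrow> 'n \<Rightarrow> nat" where
  "source_degree m i = (\<Sum>v | source v = Some i. Poly_Mapping.lookup m v)"

text \<open>The substitution made by a new copy of the index \<open>i\<close>: it subdivides an arc, or prolongs a
  path at its start (for \<open>X\<theta>\<close> and \<open>X\<theta>'\<close>) or at its end (for \<open>X\<phi>\<close> and \<open>X\<phi>'\<close>).\<close>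

primrec subdivision :: "'n \<Rightarrow> ('n, 'm) indet \<Rightarrow> (('n, 'm) indet, rat) mfps" where
  "subdivision i X\<beta> = 0"
| "subdivision i (XA j k) = mfps_var (XA j i) * mfps_var (XA i k)"
| "subdivision i (XB j k) = mfps_var (XU j i) * mfps_var (XV i k)"
| "subdivision i (XU j k) = mfps_var (XU j i) * mfps_var (XA i k)"
| "subdivision i (XV j k) = mfps_var (XA j i) * mfps_var (XV i k)"
| "subdivision i (X\<theta> k) = mfps_var (X\<theta> i) * mfps_var (XA i k)"
| "subdivision i (X\<phi> j) = mfps_var (XA j i) * mfps_var (X\<phi> i)"
| "subdivision i (X\<theta>' k) = mfps_var (X\<theta> i) * mfps_var (XV i k)"
| "subdivision i (X\<phi>' j) = mfps_var (XU j i) * mfps_var (X\<phi> i)"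

interpretation source_grading: multigrading source_degree
  by unfold_locales (simp add: fun_eq_iff source_degree_def lookup_add sum.distrib)

interpretation source_weight: weight "\<lambda>m. \<Sum>i\<in>UNIV. source_degree m i"
  by unfold_locales (simp add: source_grading.dg_add sum.distrib)

lemma source_degree_single:
  "source_degree (Poly_Mapping.single v 1) = (\<lambda>i. if source v = Some i then 1 else 0)"
proof
  fix i
  have "(\<Sum>u | source u = Some i. Poly_Mapping.lookup (Poly_Mapping.single v (1::nat)) u) =
      (\<Sum>u | source u = Some i. if u = v then 1 else 0)"
    by (rule sum.cong) (auto simp: lookup_single)
  also have "\<dots> = (if source v = Some i then 1 else 0)" by (simp add: sum.delta)
  finally show "source_degree (Poly_Mapping.single v 1) i = (if source v = Some i then 1 else 0)"
    by (simp add: source_degree_def)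
qed

lemmas source_degree_single' [simp] = source_degree_single[unfolded One_nat_def]

lemma homogeneous_var_mult_var:
  assumes "r = (\<lambda>j. (if source u = Some j then 1 else 0) + (if source u' = Some j then 1 else 0))"
  shows "homogeneous source_degree r (mfps_var u * mfps_var u')"
  using source_grading.homogeneous_mult[OF source_grading.homogeneous_var[of u] source_grading.homogeneous_var[of u']]
  unfolding assms source_degree_single .

text \<open>The new copy brings exactly one new indeterminate with source \<open>i\<close>. The value at \<open>X\<beta>\<close> is zero,
  which is homogeneous of every degree.\<close>

lemma homogeneous_subdivision:
  fixes v :: "('n::finite, 'm::finite) indet"
  shows "homogeneous source_degree
    (\<lambda>j. source_degree (Poly_Mapping.single v 1) j + (if j = i then 1 else 0)) (subdivision i v)"
  unfolding source_degree_single
  by (cases v) (auto intro!: homogeneous_var_mult_var simp: homogeneous_def[of _ _ 0] fun_eq_iff)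

lemma homogeneous_part_0_var:
  "homogeneous_part source_degree (\<lambda>_. 0) (mfps_var v) = (if source v = None then mfps_var v else 0)"
  by (rule mfps_eqI) (auto simp: coeff_var fun_eq_iff split: option.splits)

lemma vanishes_below_var: "source v \<noteq> None \<Longrightarrow> source_weight.vanishes_below 1 (mfps_var v)"
  by (auto simp: source_weight.vanishes_below_def coeff_var)

lemma homogeneous_part_0_exp:
  fixes f :: "(('n::finite, 'm::finite) indet, rat) mfps"
  assumes "source_weight.vanishes_below 1 f"
  shows "homogeneous_part source_degree (\<lambda>_. 0) (mfps_exp f) = 1"
proof (rule mfps_eqI)
  fix m
  show "mfps_coeff (homogeneous_part source_degree (\<lambda>_. 0) (mfps_exp f)) m = mfps_coeff 1 m"
    using source_weight.coeff_exp_weight_zero[OF assms, of m]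
    by (auto simp: coeff_one source_grading.dg_zero)
qed

lemma block_index_Suc:
  "block_index (r(i := Suc (r i))) = insert (Inr (i, Suc (r i))) (block_index r)"
  by (auto simp: block_index_def image_iff split: if_splits)

lemma finite_block_index: "finite (block_index r :: ('m::finite + 'n::finite \<times> nat) set)"
  by (auto simp: block_index_def)

lemma new_copy: "Inr (i, Suc (r i)) \<notin> block_index r"
  by (auto simp: block_index_def)

section \<open>Both sides of the identity satisfy the same recursion\<close>

locale generic_block =
  fixes \<beta> :: "(('n::finite, 'm::finite) indet, rat) mfps"
    and A :: "(('n, 'm) indet, rat) mfps^'n^'n"
    and B :: "(('n, 'm) indet, rat) mfps^'m^'m"
    and U :: "(('n, 'm) indet, rat) mfps^'n^'m"
    and V :: "(('n, 'm) indet, rat) mfps^'m^'n"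
    and \<theta> \<phi> :: "(('n, 'm) indet, rat) mfps^'n"
    and \<theta>' \<phi>' :: "(('n, 'm) indet, rat) mfps^'m"
  assumes \<beta>: "\<beta> = mfps_var X\<beta>"
    and A: "A = (\<chi> i j. mfps_var (XA i j))"
    and B: "B = (\<chi> i j. mfps_var (XB i j))"
    and U: "U = (\<chi> i j. mfps_var (XU i j))"
    and V: "V = (\<chi> i j. mfps_var (XV i j))"
    and \<theta>: "\<theta> = (\<chi> i. mfps_var (X\<theta> i))"
    and \<phi>: "\<phi> = (\<chi> i. mfps_var (X\<phi> i))"
    and \<theta>': "\<theta>' = (\<chi> i. mfps_var (X\<theta>' i))"
    and \<phi>': "\<phi>' = (\<chi> i. mfps_var (X\<phi>' i))"
begin

definition block_pperm :: "('n \<Rightarrow> nat) \<Rightarrow> (('n, 'm) indet, rat) mfps" where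
  "block_pperm r = ext_pperm \<beta> (block_vector \<theta>' \<theta>) (block_vector \<phi>' \<phi>) (block_index r) (block_matrix B U V A)"

text \<open>The weight of a new copy of \<open>i\<close> that forms a component by itself, either as a fixed point or as
  a path without arcs.\<close>

definition lone_vertex_weight :: "'n \<Rightarrow> (('n, 'm) indet, rat) mfps" where
  "lone_vertex_weight i = \<beta> * A $ i $ i + \<theta> $ i * \<phi> $ i"

text \<open>Subdividing arcs and prolonging paths by a new copy of \<open>i\<close> is the vector field
  \<open>subdivision i\<close>, whatever the other vertices are copies of.\<close>

lemma block_pperm_Suc:
  "block_pperm (r(i := Suc (r i))) =
    lone_vertex_weight i * block_pperm r + vector_field (subdivision i) (block_pperm r)"
proof -
  let ?x = "Inr (i, Suc (r i)) :: 'm + 'n \<times> nat"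
  interpret local_derivation "vector_field (subdivision i)"
    by (rule vector_field_local_derivation)
  have "ext_pperm \<beta> (block_vector \<theta>' \<theta>) (block_vector \<phi>' \<phi>) (insert ?x (block_index r)) (block_matrix B U V A) =
    (\<beta> * block_matrix B U V A ?x ?x + block_vector \<theta>' \<theta> ?x * block_vector \<phi>' \<phi> ?x) * block_pperm r
    + vector_field (subdivision i) (block_pperm r)"
    unfolding block_pperm_def
  proof (rule ext_pperm_insert[OF finite_block_index new_copy])
    show "vector_field (subdivision i) \<beta> = 0" by (simp add: \<beta>)
    show "vector_field (subdivision i) (block_matrix B U V A y z) =
        block_matrix B U V A y ?x * block_matrix B U V A ?x z" for y z
      by (cases y; cases z) (auto simp: A B U V)
    show "vector_field (subdivision i) (block_vector \<theta>' \<theta> z) =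
        block_vector \<theta>' \<theta> ?x * block_matrix B U V A ?x z" for z
      by (cases z) (auto simp: A V \<theta> \<theta>')
    show "vector_field (subdivision i) (block_vector \<phi>' \<phi> y) =
        block_matrix B U V A y ?x * block_vector \<phi>' \<phi> ?x" for y
      by (cases y) (auto simp: A U \<phi> \<phi>')
  qed
  then show ?thesis
    by (simp add: block_pperm_def block_index_Suc lone_vertex_weight_def)
qed

lemma block_pperm_0:
  "block_pperm (\<lambda>_. 0) = ext_pperm \<beta> (($) \<theta>') (($) \<phi>') UNIV (\<lambda>i j. B $ i $ j)"
proof -
  have "block_index (\<lambda>_. 0) = (range Inl :: ('m + 'n \<times> nat) set)"
    by (auto simp: block_index_def)
  then show ?thesis
    by (simp add: block_pperm_def ext_pperm_image)
qed

text \<open>The product \<open>u (I - A)\<^sup>-\<^sup>1 v\<^sup>T\<close>. The exponent on the right-hand side and the corrections to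
  the primed data are all of this form.\<close>

definition bilinear :: "('n \<Rightarrow> (('n, 'm) indet, rat) mfps) \<Rightarrow> ('n \<Rightarrow> (('n, 'm) indet, rat) mfps) \<Rightarrow> (('n, 'm) indet, rat) mfps" where
  "bilinear u v = (\<Sum>j\<in>UNIV. \<Sum>k\<in>UNIV. u j * inv_one_minus A $ j $ k * v k)"

text \<open>The logarithm of \<open>1 / det (I - A)\<close>.\<close>

definition log_det where
  "log_det = mfps_sum (\<lambda>t. mfps_const (1 / of_nat (Suc t)) * trace (matrix_power A (Suc t)))"

definition reduced_pperm where
  "reduced_pperm = ext_pperm \<beta> (\<lambda>k. \<theta>' $ k + bilinear (($) \<theta>) (\<lambda>l. V $ l $ k))
    (\<lambda>j. \<phi>' $ j + bilinear (($) (U $ j)) (($) \<phi>)) UNIV (\<lambda>j k. B $ j $ k + bilinear (($) (U $ j)) (\<lambda>l. V $ l $ k))"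

text \<open>The right-hand side of the identity.\<close>

definition reduced_series where
  "reduced_series = mfps_exp (bilinear (($) \<theta>) (($) \<phi>)) * reduced_pperm * mfps_exp (\<beta> * log_det)"

text \<open>The right-hand side is to satisfy the same recursion as the permanents, which in generating
  series form says that the Euler operator of the degree in \<open>i\<close> acts on it as multiplication by
  \<open>lone_vertex_weight i\<close> plus the vector field \<open>subdivision i\<close>. The difference of these two
  derivations is again a derivation, and a much simpler one on everything
  that involves the inverse of \<open>I - A\<close>.\<close>

definition delta :: "'n \<Rightarrow> (('n, 'm) indet, rat) mfps \<Rightarrow> (('n, 'm) indet, rat) mfps" where
  "delta i f = mfps_euler (\<lambda>m. source_degree m i) f + (- 1) * vector_field (subdivision i) f"

lemma delta_local_derivation: "local_derivation (delta i)"
proof -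
  have "weight (\<lambda>m :: ('n, 'm) indet \<Rightarrow>\<^sub>0 nat. source_degree m i)"
    by unfold_locales (simp add: source_grading.dg_add)
  then have "local_derivation (mfps_euler (\<lambda>m. source_degree m i) :: (('n, 'm) indet, rat) mfps \<Rightarrow> _)"
    by (rule weight.euler_local_derivation)
  then have "local_derivation (\<lambda>f :: (('n, 'm) indet, rat) mfps.
      mfps_euler (\<lambda>m. source_degree m i) f + (- 1) * vector_field (subdivision i) f)"
    by (intro local_derivation_add local_derivation_scale vector_field_local_derivation)
  moreover have "delta i = (\<lambda>f. mfps_euler (\<lambda>m. source_degree m i) f + (- 1) * vector_field (subdivision i) f)"
    by (rule ext) (rule delta_def)
  ultimately show ?thesis by simp
qed

lemma delta_var: "delta i (mfps_var v) = (if source v = Some i then mfps_var v else 0) - subdivision i v"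
  by (simp add: delta_def euler_var)

lemma delta_entries:
  "delta i \<beta> = 0"
  "delta i (A $ j $ k) = (mat 1 - A) $ j $ i * A $ i $ k"
  "delta i (V $ j $ l) = (mat 1 - A) $ j $ i * V $ i $ l"
  "delta i (\<phi> $ j) = (mat 1 - A) $ j $ i * \<phi> $ i"
  "delta i (U $ l $ k) = - U $ l $ i * A $ i $ k"
  "delta i (\<theta> $ k) = - \<theta> $ i * A $ i $ k"
  "delta i (B $ l $ l') = - U $ l $ i * V $ i $ l'"
  "delta i (\<theta>' $ l) = - \<theta> $ i * V $ i $ l"
  "delta i (\<phi>' $ l) = - U $ l $ i * \<phi> $ i"
  by (simp_all add: \<beta> A B U V \<theta> \<phi> \<theta>' \<phi>' delta_var mat_def left_diff_distrib)

lemma A_vanishes: "source_weight.vanishes_below 1 (A $ j $ k)"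
  using vanishes_below_var[of "XA j k"] by (simp add: A)

text \<open>In particular \<open>delta i\<close> of \<open>U (I - A)\<^sup>-\<^sup>1 V\<close> is minus that of \<open>B\<close>, and similarly for
  the two vectors.\<close>

lemma delta_bilinear:
  assumes "\<And>k. delta i (u k) = - u i * A $ i $ k" "\<And>j. delta i (v j) = (mat 1 - A) $ j $ i * v i"
  shows "delta i (bilinear u v) = u i * v i"
  unfolding bilinear_def
  using A_vanishes delta_local_derivation delta_entries(2) assms
  by (rule source_weight.derivation_bilinear)

lemma bilinear_vanishes: "(\<And>k. source_weight.vanishes_below 1 (v k)) \<Longrightarrow> source_weight.vanishes_below 1 (bilinear u v)"
  unfolding bilinear_def
  by (intro source_weight.vanishes_below_sum source_weight.vanishes_below_1_mult)

lemma exponents_vanish: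
  "source_weight.vanishes_below 1 (bilinear (($) \<theta>) (($) \<phi>))"
  "source_weight.vanishes_below 1 (\<beta> * log_det)"
proof -
  show "source_weight.vanishes_below 1 (bilinear (($) \<theta>) (($) \<phi>))"
  proof (rule bilinear_vanishes)
    show "source_weight.vanishes_below 1 (\<phi> $ k)" for k
      using vanishes_below_var[of "X\<phi> k"] by (simp add: \<phi>)
  qed
  show "source_weight.vanishes_below 1 (\<beta> * log_det)"
    unfolding log_det_def
    by (rule source_weight.vanishes_below_1_mult[OF source_weight.log_det_has_sum(2)[OF A_vanishes]])
qed

text \<open>The reduced permanent has entries that \<open>delta i\<close> annihilates, so it behaves as a constant;
  the logarithmic derivatives of the two exponential factors are the two summands of the
  weight of a lone vertex.\<close>

lemma delta_reduced_series: "delta i reduced_series = lone_vertex_weight i * reduced_series"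
proof -
  interpret local_derivation "delta i" by (rule delta_local_derivation)
  have "delta i reduced_pperm = 0"
    unfolding reduced_pperm_def
    by (rule ext_pperm_zero) (simp_all add: add delta_entries delta_bilinear)
  moreover have "delta i (bilinear (($) \<theta>) (($) \<phi>)) = \<theta> $ i * \<phi> $ i"
    by (rule delta_bilinear) (simp_all add: delta_entries)
  moreover have "delta i log_det = A $ i $ i"
    unfolding log_det_def using A_vanishes delta_local_derivation delta_entries(2)
    by (rule source_weight.derivation_log_det)
  ultimately show ?thesis
    unfolding reduced_series_def lone_vertex_weight_def mult
      source_weight.derivation_exp[OF delta_local_derivation exponents_vanish(1)]
      source_weight.derivation_exp[OF delta_local_derivation exponents_vanish(2)]
    by (simp add: delta_entries(1) algebra_simps)
qed

lemma homogeneous_part_reduced_series_Suc: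
  "of_nat (Suc (r i)) * homogeneous_part source_degree (r(i := Suc (r i))) reduced_series =
    lone_vertex_weight i * homogeneous_part source_degree r reduced_series
    + vector_field (subdivision i) (homogeneous_part source_degree r reduced_series)"
proof -
  let ?e = "\<lambda>j. if j = i then 1 else (0::nat)"
  have r: "r(i := Suc (r i)) = (\<lambda>j. r j + ?e j)" by auto
  have "mfps_euler (\<lambda>m. source_degree m i) reduced_series = lone_vertex_weight i * reduced_series + vector_field (subdivision i) reduced_series"
    using delta_reduced_series[of i] by (simp add: delta_def algebra_simps)
  moreover have "of_nat (Suc (r i)) * homogeneous_part source_degree (r(i := Suc (r i))) reduced_series =
      homogeneous_part source_degree (r(i := Suc (r i))) (mfps_euler (\<lambda>m. source_degree m i) reduced_series)"
    unfolding of_nat_eq_const by (rule mfps_eqI) auto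
  moreover have "homogeneous source_degree ?e (lone_vertex_weight i)"
    unfolding lone_vertex_weight_def
    by (intro source_grading.homogeneous_add)
      (auto simp: \<beta> A \<theta> \<phi> fun_eq_iff intro!: homogeneous_var_mult_var)
  ultimately show ?thesis
    unfolding r
    by (simp add: homogeneous_part_add source_grading.homogeneous_part_mult
        homogeneous_part_vector_field[OF source_grading.multigrading_axioms homogeneous_subdivision])
qed

text \<open>Degree zero means setting \<open>A\<close>, \<open>V\<close> and \<open>\<phi>\<close> to zero, which is a ring homomorphism.\<close>

lemma homogeneous_part_reduced_series_0:
  "homogeneous_part source_degree (\<lambda>_. 0) reduced_series = block_pperm (\<lambda>_. 0)"
proof -
  let ?h = "homogeneous_part source_degree (\<lambda>_. 0) :: (('n, 'm) indet, rat) mfps \<Rightarrow> _"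
  have one: "?h 1 = 1" and zero: "?h 0 = 0"
    by (rule mfps_eqI; auto simp: coeff_one source_grading.dg_zero)+
  have bil: "?h (bilinear u v) = 0" if "\<And>k. ?h (v k) = 0" for u v
    unfolding bilinear_def homogeneous_part_sum source_grading.homogeneous_part_0_mult that by simp
  have "?h reduced_series = ?h reduced_pperm"
    unfolding reduced_series_def source_grading.homogeneous_part_0_mult
      homogeneous_part_0_exp[OF exponents_vanish(1)] homogeneous_part_0_exp[OF exponents_vanish(2)]
    by simp
  also have "\<dots> = ext_pperm \<beta> (($) \<theta>') (($) \<phi>') UNIV (\<lambda>i j. B $ i $ j)"
    unfolding reduced_pperm_def
    by (subst ext_pperm_hom[of ?h])
      (simp_all add: one zero source_grading.homogeneous_part_0_mult homogeneous_part_add bil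
        \<beta> B V \<phi> \<theta>' \<phi>' homogeneous_part_0_var vec_lambda_inverse)
  finally show ?thesis by (simp add: block_pperm_0)
qed

text \<open>Both sides satisfy the same recursion in each \<open>r i\<close> and agree at \<open>r = 0\<close>; the factor
  \<open>Suc (r i)\<close> produced by the Euler operator accounts for the factorials.\<close>

lemma homogeneous_part_reduced_series:
  "homogeneous_part source_degree r reduced_series = mfps_const (1 / (\<Prod>i\<in>UNIV. fact (r i))) * block_pperm r"
proof (induction "\<Sum>i\<in>UNIV. r i" arbitrary: r rule: less_induct)
  case less
  show ?case
  proof (cases "r = (\<lambda>_. 0)")
    case True
    then show ?thesis by (simp add: homogeneous_part_reduced_series_0)
  next
    case False
    then obtain i where i: "r i \<noteq> 0" by auto
    define s where "s = r(i := r i - 1)"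
    have r: "r = s(i := Suc (s i))" using i by (auto simp: s_def)
    have "(\<Sum>i\<in>UNIV. s i) < (\<Sum>i\<in>UNIV. r i)"
      by (rule sum_strict_mono_ex1) (use i in \<open>auto simp: s_def\<close>)
    note IH = less.hyps[OF this]
    interpret local_derivation "vector_field (subdivision i) :: (('n, 'm) indet, rat) mfps \<Rightarrow> _"
      by (rule vector_field_local_derivation)
    let ?c = "1 / (\<Prod>i\<in>UNIV. fact (s i)) :: rat"
    have "of_nat (Suc (s i)) * homogeneous_part source_degree r reduced_series = mfps_const ?c * block_pperm r"
      unfolding r homogeneous_part_reduced_series_Suc block_pperm_Suc IH const_mult
      by (simp add: algebra_simps)
    then have "mfps_const (1 / of_nat (Suc (s i))) * (of_nat (Suc (s i)) * homogeneous_part source_degree r reduced_series) =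
        mfps_const (1 / of_nat (Suc (s i))) * (mfps_const ?c * block_pperm r)"
      by (rule arg_cong)
    then have "homogeneous_part source_degree r reduced_series = mfps_const (1 / of_nat (Suc (s i)) * ?c) * block_pperm r"
      unfolding of_nat_eq_const mult.assoc[symmetric] mfps_const_mult[symmetric]
      by (simp del: of_nat_Suc)
    moreover have "(\<Prod>i\<in>UNIV. fact (r i)) = of_nat (Suc (s i)) * (\<Prod>i\<in>UNIV. fact (s i) :: rat)"
    proof -
      have "(\<Prod>j\<in>UNIV. fact (r j)) = fact (r i) * (\<Prod>j\<in>UNIV - {i}. fact (r j) :: rat)"
        by (rule prod.remove) simp_all
      also have "(\<Prod>j\<in>UNIV - {i}. fact (r j) :: rat) = (\<Prod>j\<in>UNIV - {i}. fact (s j))"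
        by (rule prod.cong) (auto simp: s_def)
      also have "fact (r i) = of_nat (Suc (s i)) * (fact (s i) :: rat)"
        unfolding r by simp
      also have "of_nat (Suc (s i)) * fact (s i) * (\<Prod>j\<in>UNIV - {i}. fact (s j) :: rat) =
          of_nat (Suc (s i)) * (\<Prod>j\<in>UNIV. fact (s j))"
        by (subst prod.remove[of UNIV i]) (simp_all add: mult.assoc)
      finally show ?thesis .
    qed
    ultimately show ?thesis by simp
  qed
qed

end

theorem theorem5p1:
  fixes \<beta> :: "(('n::finite, 'm::finite) indet, rat) mfps"
    and A Ainv :: "(('n, 'm) indet, rat) mfps^'n^'n"
    and B B_tilde :: "(('n, 'm) indet, rat) mfps^'m^'m"
    and U :: "(('n, 'm) indet, rat) mfps^'n^'m"
    and V :: "(('n, 'm) indet, rat) mfps^'m^'n"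
    and \<theta> \<phi> :: "(('n, 'm) indet, rat) mfps^'n"
    and \<theta>' \<phi>' \<theta>_tilde \<phi>_tilde :: "(('n, 'm) indet, rat) mfps^'m"
  assumes "\<beta> = mfps_var X\<beta>"
    and "A = (\<chi> i j. mfps_var (XA i j))"
    and "B = (\<chi> i j. mfps_var (XB i j))"
    and "U = (\<chi> i j. mfps_var (XU i j))"
    and "V = (\<chi> i j. mfps_var (XV i j))"
    and "\<theta> = (\<chi> i. mfps_var (X\<theta> i))"
    and "\<phi> = (\<chi> i. mfps_var (X\<phi> i))"
    and "\<theta>' = (\<chi> i. mfps_var (X\<theta>' i))"
    and "\<phi>' = (\<chi> i. mfps_var (X\<phi>' i))"
    and "Ainv = inv_one_minus A"
    and "B_tilde = B + U ** Ainv ** V"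
    and "\<theta>_tilde = \<theta>' + \<theta> v* Ainv v* V"
    and "\<phi>_tilde = \<phi>' + U *v (Ainv *v \<phi>)"
  shows "mfps_has_sum
    (\<lambda>r :: 'n \<Rightarrow> nat. mfps_const (1 / (\<Prod>i\<in>UNIV. fact (r i))) *
       ext_pperm \<beta> (block_vector \<theta>' \<theta>) (block_vector \<phi>' \<phi>) (block_index r)
         (block_matrix B U V A))
    (mfps_exp (\<Sum>i\<in>UNIV. (\<theta> v* Ainv) $ i * \<phi> $ i) *
       ext_pperm \<beta> (($) \<theta>_tilde) (($) \<phi>_tilde) UNIV (\<lambda>i j. B_tilde $ i $ j) *
       det_one_minus_neg_power A \<beta>)"
proof -
  interpret generic_block \<beta> A B U V \<theta> \<phi> \<theta>' \<phi>'
    using assms(1-9) by unfold_locales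
  have swap: "(\<Sum>k\<in>UNIV. (\<Sum>j\<in>UNIV. u j * Ainv $ j $ k) * v k) = bilinear u v" for u v
    unfolding bilinear_def assms(10) sum_distrib_right by (rule sum.swap)
  have "(\<Sum>i\<in>UNIV. (\<theta> v* Ainv) $ i * \<phi> $ i) = bilinear (($) \<theta>) (($) \<phi>)"
    by (simp add: vector_matrix_mult_def swap)
  moreover have "B_tilde $ j $ k = B $ j $ k + bilinear (($) (U $ j)) (\<lambda>l. V $ l $ k)" for j k
    by (simp add: assms(11) matrix_mult_nth swap)
  moreover have "($) \<theta>_tilde = (\<lambda>k. \<theta>' $ k + bilinear (($) \<theta>) (\<lambda>l. V $ l $ k))"
    by (rule ext) (simp add: assms(12) vector_matrix_mult_def swap)
  moreover have "($) \<phi>_tilde = (\<lambda>j. \<phi>' $ j + bilinear (($) (U $ j)) (($) \<phi>))"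
    by (rule ext) (simp add: assms(13) matrix_vector_mult_def bilinear_def assms(10) sum_distrib_left mult.assoc)
  ultimately have "mfps_exp (\<Sum>i\<in>UNIV. (\<theta> v* Ainv) $ i * \<phi> $ i) *
       ext_pperm \<beta> (($) \<theta>_tilde) (($) \<phi>_tilde) UNIV (\<lambda>i j. B_tilde $ i $ j) *
       det_one_minus_neg_power A \<beta> = reduced_series"
    by (simp only: reduced_series_def reduced_pperm_def det_one_minus_neg_power_def log_det_def)
  then show ?thesis
    using has_sum_homogeneous_parts[of source_degree reduced_series]
    unfolding homogeneous_part_reduced_series block_pperm_def by simp
qed

end
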